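(* The following groups are not strongly verbally closed: (1) every non-abelian braid group (i.e. the Artin braid group $B_n$ on $n$ strands for each $n\ge 3$); (2) the group $\mathrm{SL}_n(\mathbb{Z})$ for every even positive integer $n$.
   Context: A subgroup $H$ of a group $G$ is verbally closed in $G$ if every equation of the form $w(x_1,\dots,x_r)=h$, where $w$ is an element of the free group $F(x_1,\dots,x_r)$ and $h\in H$, has a solution in $G$ if and only if it has a solution in $H$. A subgroup $H$ of $G$ is algebraically closed in $G$ if every finite system of equations $\{w_1(x_1,\dots,x_r)=1,\dots,w_m(x_1,\dots,x_r)=1\}$ with coefficients from $H$, i.e. with $w_i\in H*F(x_1,\dots,x_r)$ (free product), has a solution in $G$ if and only if it has a solution in $H$. A group $H$ is strongly verbally closed if it is algebraically closed in every group containing $H$ as a verbally closed subgroup. *)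

theory Defs
  imports "HOL-Algebra.Algebra" "Jordan_Normal_Form.Determinant"
begin

section \<open>Groups given by generators and relations\<close>

text \<open>The letter \<open>(a, True)\<close> stands for the generator \<open>a\<close>, and \<open>(a, False)\<close> for its inverse.\<close>

type_synonym 'a gword = "('a \<times> bool) list"

definition words :: "'a set \<Rightarrow> 'a gword set" where
  "words S = lists (S \<times> UNIV)"

inductive_set pres_rel :: "'a set \<Rightarrow> ('a gword \<times> 'a gword) set \<Rightarrow> ('a gword \<times> 'a gword) set"
  for S R where
  refl: "w \<in> words S \<Longrightarrow> (w, w) \<in> pres_rel S R"
| sym: "(u, v) \<in> pres_rel S R \<Longrightarrow> (v, u) \<in> pres_rel S R"
| trans: "(u, v) \<in> pres_rel S R \<Longrightarrow> (v, w) \<in> pres_rel S R \<Longrightarrow> (u, w) \<in> pres_rel S R"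
| cancel: "u \<in> words S \<Longrightarrow> v \<in> words S \<Longrightarrow> a \<in> S \<Longrightarrow>
    (u @ [(a, b), (a, \<not> b)] @ v, u @ v) \<in> pres_rel S R"
| relator: "u \<in> words S \<Longrightarrow> v \<in> words S \<Longrightarrow> (l, r) \<in> R \<Longrightarrow> l \<in> words S \<Longrightarrow> r \<in> words S \<Longrightarrow>
    (u @ l @ v, u @ r @ v) \<in> pres_rel S R"

definition presented_group :: "'a set \<Rightarrow> ('a gword \<times> 'a gword) set \<Rightarrow> 'a gword set monoid" where
  "presented_group S R =
    \<lparr> carrier = words S // pres_rel S R,
      monoid.mult = (\<lambda>A B. \<Union>a\<in>A. \<Union>b\<in>B. pres_rel S R `` {a @ b}),
      one = pres_rel S R `` {[]} \<rparr>"

definition free_group :: "'a set \<Rightarrow> 'a gword set monoid" where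
  "free_group S = presented_group S {}"

text \<open>The free product of \<open>H\<close> with the free group on \<open>x\<^sub>0, \<dots>, x\<^sub>r\<^sub>-\<^sub>1\<close>: generated by the
  elements of \<open>H\<close> and the \<open>x\<^sub>i\<close>, with the multiplication table of \<open>H\<close> as relations.\<close>

definition free_product_free ::
  "('a, 'b) monoid_scheme \<Rightarrow> nat \<Rightarrow> ('a + nat) gword set monoid" where
  "free_product_free H r = presented_group (Inl ` carrier H \<union> Inr ` {..<r})
    {([(Inl a, True), (Inl b, True)], [(Inl (a \<otimes>\<^bsub>H\<^esub> b), True)]) | a b.
      a \<in> carrier H \<and> b \<in> carrier H}"


section \<open>Equations over groups\<close>

definition word_eval :: "('g, 'm) monoid_scheme \<Rightarrow> ('a \<Rightarrow> 'g) \<Rightarrow> 'a gword \<Rightarrow> 'g" where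
  "word_eval G v w = foldr (\<lambda>(a, b) g. (if b then v a else inv\<^bsub>G\<^esub> v a) \<otimes>\<^bsub>G\<^esub> g) w \<one>\<^bsub>G\<^esub>"

text \<open>The value at \<open>v\<close> of an element \<open>W\<close> of a presented group, i.e. of a class of words.
  It is the common value of the words in \<open>W\<close> if \<open>v\<close> satisfies the relations,
  see \<open>value_at_class\<close> below.\<close>

definition value_at :: "('g, 'm) monoid_scheme \<Rightarrow> ('a \<Rightarrow> 'g) \<Rightarrow> 'a gword set \<Rightarrow> 'g" where
  "value_at G v W = the_elem (word_eval G v ` W)"

definition verbally_closed_in :: "'g set \<Rightarrow> ('g, 'm) monoid_scheme \<Rightarrow> bool" where
  "verbally_closed_in H G \<longleftrightarrow> subgroup H G \<and>
    (\<forall>r. \<forall>W \<in> carrier (free_group {..<r::nat}). \<forall>h \<in> H.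
      (\<exists>x \<in> {..<r} \<rightarrow> carrier G. value_at G x W = h) \<longleftrightarrow>
      (\<exists>x \<in> {..<r} \<rightarrow> H. value_at G x W = h))"

definition algebraically_closed_in :: "'g set \<Rightarrow> ('g, 'm) monoid_scheme \<Rightarrow> bool" where
  "algebraically_closed_in H G \<longleftrightarrow> subgroup H G \<and>
    (\<forall>r. \<forall>E \<subseteq> carrier (free_product_free (G\<lparr>carrier := H\<rparr>) r). finite E \<longrightarrow>
      ((\<exists>x \<in> {..<r} \<rightarrow> carrier G. \<forall>W \<in> E. value_at G (case_sum (\<lambda>h. h) x) W = \<one>\<^bsub>G\<^esub>) \<longleftrightarrow>
       (\<exists>x \<in> {..<r} \<rightarrow> H. \<forall>W \<in> E. value_at G (case_sum (\<lambda>h. h) x) W = \<one>\<^bsub>G\<^esub>)))"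

text \<open>HOL cannot quantify over the element types of the groups containing \<open>H\<close>, and a group
  containing \<open>H\<close> is rendered as a group \<open>G\<close> with an injective homomorphism \<open>H \<rightarrow> G\<close>. The type
  below is large enough for every group generated by \<open>H\<close> and finitely many elements; this loses
  nothing, as \<open>strongly_verbally_closedD\<close> below extends the property to groups \<open>G\<close> over
  arbitrary types.\<close>

definition strongly_verbally_closed :: "('a, 'b) monoid_scheme \<Rightarrow> bool" where
  "strongly_verbally_closed H \<longleftrightarrow>
    (\<forall>(G :: ('a + nat) gword monoid) \<phi>.
      group G \<and> \<phi> \<in> mon H G \<and> verbally_closed_in (\<phi> ` carrier H) G \<longrightarrow>
      algebraically_closed_in (\<phi> ` carrier H) G)"


section \<open>The groups in question\<close>

text \<open>Artin's presentation; the generators are \<open>\<sigma>\<^sub>1, \<dots>, \<sigma>\<^sub>n\<^sub>-\<^sub>1\<close>.\<close>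

definition braid_group :: "nat \<Rightarrow> nat gword set monoid" where
  "braid_group n = presented_group {1..<n}
    ({([(i, True), (j, True)], [(j, True), (i, True)]) | i j.
        i \<in> {1..<n} \<and> j \<in> {1..<n} \<and> i + 2 \<le> j} \<union>
     {([(i, True), (i + 1, True), (i, True)], [(i + 1, True), (i, True), (i + 1, True)]) | i.
        i \<in> {1..<n} \<and> i + 1 \<in> {1..<n}})"

definition SL_int :: "nat \<Rightarrow> int mat monoid" where
  "SL_int n = \<lparr> carrier = {A \<in> carrier_mat n n. det A = 1}, monoid.mult = (*), one = 1\<^sub>m n \<rparr>"


section \<open>Well-definedness\<close>

lemma words_simps [simp]:
  "[] \<in> words S" "p # w \<in> words S \<longleftrightarrow> fst p \<in> S \<and> w \<in> words S"
  "u @ w \<in> words S \<longleftrightarrow> u \<in> words S \<and> w \<in> words S"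
  by (auto simp: words_def mem_Times_iff)

lemma pres_rel_words: "(u, v) \<in> pres_rel S R \<Longrightarrow> u \<in> words S \<and> v \<in> words S"
  by (induction rule: pres_rel.induct) auto

lemma equiv_pres_rel: "equiv (words S) (pres_rel S R)"
proof (rule equivI)
  show "refl_on (words S) (pres_rel S R)"
    by (auto intro!: refl_onI pres_rel.refl)
  show "sym (pres_rel S R)" by (meson symI pres_rel.sym)
  show "trans (pres_rel S R)" by (meson transI pres_rel.trans)
  show "pres_rel S R \<subseteq> words S \<times> words S" using pres_rel_words by auto
qed

lemma pres_rel_append_left:
  "(u, v) \<in> pres_rel S R \<Longrightarrow> a \<in> words S \<Longrightarrow> (a @ u, a @ v) \<in> pres_rel S R"
proof (induction rule: pres_rel.induct)
  case (cancel u v c b)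
  then show ?case using pres_rel.cancel[of "a @ u" S v c b R] by simp
next
  case (relator u v l r)
  then show ?case using pres_rel.relator[of "a @ u" S v l r R] by simp
next
  case (trans u v w)
  then show ?case by (meson pres_rel.trans)
qed (auto intro: pres_rel.refl pres_rel.sym)

lemma pres_rel_append_right:
  "(u, v) \<in> pres_rel S R \<Longrightarrow> a \<in> words S \<Longrightarrow> (u @ a, v @ a) \<in> pres_rel S R"
proof (induction rule: pres_rel.induct)
  case (cancel u v c b)
  then show ?case using pres_rel.cancel[of u S "v @ a" c b R] by simp
next
  case (relator u v l r)
  then show ?case using pres_rel.relator[of u S "v @ a" l r R] by simp
next
  case (trans u v w)
  then show ?case by (meson pres_rel.trans)
qed (auto intro: pres_rel.refl pres_rel.sym)

lemma presented_group_mult: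
  assumes "u \<in> words S" "w \<in> words S"
  shows "(pres_rel S R `` {u}) \<otimes>\<^bsub>presented_group S R\<^esub> (pres_rel S R `` {w}) =
    pres_rel S R `` {u @ w}"
proof -
  have "pres_rel S R `` {a @ b} = pres_rel S R `` {u @ w}"
    if "(u, a) \<in> pres_rel S R" "(w, b) \<in> pres_rel S R" for a b
  proof -
    have "(u @ w, a @ w) \<in> pres_rel S R" "(a @ w, a @ b) \<in> pres_rel S R"
      using that assms pres_rel_words pres_rel_append_left pres_rel_append_right by blast+
    then show ?thesis
      by (metis equiv_class_eq equiv_pres_rel pres_rel.trans)
  qed
  note * = this
  have "(u, u) \<in> pres_rel S R" "(w, w) \<in> pres_rel S R"
    using assms by (auto intro: pres_rel.refl)
  then have "(\<Union>a\<in>pres_rel S R `` {u}. \<Union>b\<in>pres_rel S R `` {w}. pres_rel S R `` {a @ b}) =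
      (\<Union>a\<in>pres_rel S R `` {u}. \<Union>b\<in>pres_rel S R `` {w}. pres_rel S R `` {u @ w})"
    by (intro SUP_cong HOL.refl *) simp_all
  also have "\<dots> = pres_rel S R `` {u @ w}"
    using \<open>(u, u) \<in> _\<close> \<open>(w, w) \<in> _\<close> by blast
  finally show ?thesis
    by (simp add: presented_group_def)
qed

lemma pres_rel_inverse:
  assumes "w \<in> words S"
  shows "(rev (map (\<lambda>(a, b). (a, \<not> b)) w) @ w, []) \<in> pres_rel S R"
  using assms
proof (induction w)
  case Nil
  then show ?case by (auto intro: pres_rel.refl)
next
  case (Cons p w)
  obtain a b where p: "p = (a, b)" by (cases p)
  have w': "rev (map (\<lambda>(a, b). (a, \<not> b)) w) \<in> words S"
    using Cons.prems by (force simp: words_def mem_Times_iff)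
  have "(rev (map (\<lambda>(a, b). (a, \<not> b)) w) @ [(a, \<not> b), (a, \<not> \<not> b)] @ w,
      rev (map (\<lambda>(a, b). (a, \<not> b)) w) @ w) \<in> pres_rel S R"
    using Cons.prems w' p by (intro pres_rel.cancel) auto
  moreover have "(rev (map (\<lambda>(a, b). (a, \<not> b)) w) @ w, []) \<in> pres_rel S R"
    using Cons by simp
  ultimately have "(rev (map (\<lambda>(a, b). (a, \<not> b)) w) @ [(a, \<not> b), (a, \<not> \<not> b)] @ w, [])
      \<in> pres_rel S R"
    by (rule pres_rel.trans)
  then show ?case by (simp add: p)
qed

lemma group_presented_group: "group (presented_group S R)"
proof (rule groupI)
  let ?G = "presented_group S R" and ?c = "\<lambda>w. pres_rel S R `` {w}"
  have carr: "carrier ?G = ?c ` words S" "\<one>\<^bsub>?G\<^esub> = ?c []"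
    by (auto simp: presented_group_def quotient_def)
  note mult = presented_group_mult[of _ S _ R]
  show "x \<otimes>\<^bsub>?G\<^esub> y \<in> carrier ?G" if "x \<in> carrier ?G" "y \<in> carrier ?G" for x y
    using that by (auto simp: carr mult)
  show "\<one>\<^bsub>?G\<^esub> \<in> carrier ?G"
    by (auto simp: carr)
  show "x \<otimes>\<^bsub>?G\<^esub> y \<otimes>\<^bsub>?G\<^esub> z = x \<otimes>\<^bsub>?G\<^esub> (y \<otimes>\<^bsub>?G\<^esub> z)"
    if "x \<in> carrier ?G" "y \<in> carrier ?G" "z \<in> carrier ?G" for x y z
    using that by (auto simp: carr mult)
  show "\<one>\<^bsub>?G\<^esub> \<otimes>\<^bsub>?G\<^esub> x = x" if "x \<in> carrier ?G" for x
    using that by (auto simp: carr mult)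
  show "\<exists>y\<in>carrier ?G. y \<otimes>\<^bsub>?G\<^esub> x = \<one>\<^bsub>?G\<^esub>" if x: "x \<in> carrier ?G" for x
  proof -
    obtain w where w: "w \<in> words S" "x = ?c w" using x by (auto simp: carr)
    let ?w = "rev (map (\<lambda>(a, b). (a, \<not> b)) w)"
    have w': "?w \<in> words S"
      using w by (force simp: words_def mem_Times_iff)
    have "?c (?w @ w) = ?c []"
      using equiv_class_eq[OF equiv_pres_rel pres_rel_inverse[OF w(1)]] .
    with w w' show ?thesis by (auto simp: carr mult intro!: bexI[of _ ?w])
  qed
qed

lemma group_SL_int: "group (SL_int n)"
proof (rule groupI)
  show "\<exists>y\<in>carrier (SL_int n). y \<otimes>\<^bsub>SL_int n\<^esub> x = \<one>\<^bsub>SL_int n\<^esub>" if "x \<in> carrier (SL_int n)" for x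
  proof -
    have x: "x \<in> carrier_mat n n" "det x = 1" using that by (auto simp: SL_int_def)
    have a: "adj_mat x \<in> carrier_mat n n" "adj_mat x * x = 1\<^sub>m n"
      using adj_mat[OF x(1)] x(2) by auto
    have "det (adj_mat x) = 1"
      using det_mult[OF a(1) x(1)] a(2) x(2) by simp
    with a show ?thesis by (auto simp: SL_int_def)
  qed
qed (auto simp: SL_int_def det_mult)

lemma word_eval_Nil [simp]: "word_eval G v [] = \<one>\<^bsub>G\<^esub>"
  by (simp add: word_eval_def)

lemma word_eval_Cons [simp]:
  "word_eval G v (p # w) = (if snd p then v (fst p) else inv\<^bsub>G\<^esub> v (fst p)) \<otimes>\<^bsub>G\<^esub> word_eval G v w"
  by (simp add: word_eval_def split: prod.splits)

context group
begin

lemma word_eval_closed [simp]: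
  "w \<in> words S \<Longrightarrow> v \<in> S \<rightarrow> carrier G \<Longrightarrow> word_eval G v w \<in> carrier G"
  by (induction w) (auto simp: Pi_iff)

lemma word_eval_append:
  assumes "v \<in> S \<rightarrow> carrier G" "u \<in> words S" "w \<in> words S"
  shows "word_eval G v (u @ w) = word_eval G v u \<otimes> word_eval G v w"
  using assms(2)
proof (induction u)
  case Nil
  then show ?case using assms by simp
next
  case (Cons p u)
  have "v (fst p) \<in> carrier G" "word_eval G v u \<in> carrier G" "word_eval G v w \<in> carrier G"
    using Cons.prems assms by (auto simp: Pi_iff)
  then show ?case using Cons by (simp add: m_assoc)
qed

lemma word_eval_pres_rel:
  assumes v: "v \<in> S \<rightarrow> carrier G"
    and R: "\<And>l r. (l, r) \<in> R \<Longrightarrow> word_eval G v l = word_eval G v r"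
    and "(u, w) \<in> pres_rel S R"
  shows "word_eval G v u = word_eval G v w"
  using assms(3)
proof (induction rule: pres_rel.induct)
  case (cancel u w a b)
  have "v a \<in> carrier G" "word_eval G v w \<in> carrier G"
    using cancel v by auto
  then have "word_eval G v ([(a, b), (a, \<not> b)] @ w) = word_eval G v w"
    by (simp flip: m_assoc)
  then show ?case
    using cancel v word_eval_append[OF v, of u "[(a, b), (a, \<not> b)] @ w"]
      word_eval_append[OF v, of u w] by simp
next
  case (relator u w l r)
  then show ?case
    using R by (simp add: word_eval_append[OF v])
qed auto

text \<open>\<open>value_at\<close> is the evaluation of classes of words that \<open>v\<close> induces.\<close>

lemma value_at_class:
  assumes "v \<in> S \<rightarrow> carrier G"
    and "\<And>l r. (l, r) \<in> R \<Longrightarrow> word_eval G v l = word_eval G v r"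
    and "w \<in> words S"
  shows "value_at G v (pres_rel S R `` {w}) = word_eval G v w"
proof -
  have "word_eval G v ` (pres_rel S R `` {w}) = {word_eval G v w}"
    using word_eval_pres_rel[OF assms(1,2)] pres_rel.refl[OF assms(3)] by (force simp: image_iff)
  then show ?thesis by (simp add: value_at_def)
qed

lemma verbally_closed_in_words:
  "verbally_closed_in H G \<longleftrightarrow> subgroup H G \<and>
    (\<forall>r. \<forall>w \<in> words {..<r::nat}. \<forall>h \<in> H.
      (\<exists>x \<in> {..<r} \<rightarrow> carrier G. word_eval G x w = h) \<longleftrightarrow>
      (\<exists>x \<in> {..<r} \<rightarrow> H. word_eval G x w = h))"
proof (cases "subgroup H G")
  case True
  have carr: "carrier (free_group {..<r::nat}) = (\<lambda>w. pres_rel {..<r} {} `` {w}) ` words {..<r}" for r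
    by (auto simp: free_group_def presented_group_def quotient_def)
  have val: "value_at G x (pres_rel {..<r} {} `` {w}) = word_eval G x w"
    if "w \<in> words {..<r::nat}" "x \<in> {..<r} \<rightarrow> carrier G" for r x w
    using that by (intro value_at_class) auto
  have sub: "x \<in> {..<r} \<rightarrow> carrier G" if "x \<in> {..<r::nat} \<rightarrow> H" for x r
    using that subgroup.subset[OF True] by auto
  show ?thesis
    unfolding verbally_closed_in_def carr ball_simps
    by (simp add: True val sub cong: bex_cong)
qed (simp add: verbally_closed_in_def)

lemma algebraically_closed_in_words:
  "algebraically_closed_in H G \<longleftrightarrow> subgroup H G \<and>
    (\<forall>r. \<forall>E \<subseteq> words (Inl ` H \<union> Inr ` {..<r::nat}). finite E \<longrightarrow>
      ((\<exists>x \<in> {..<r} \<rightarrow> carrier G. \<forall>w \<in> E. word_eval G (case_sum (\<lambda>h. h) x) w = \<one>) \<longleftrightarrow>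
       (\<exists>x \<in> {..<r} \<rightarrow> H. \<forall>w \<in> E. word_eval G (case_sum (\<lambda>h. h) x) w = \<one>)))"
proof (cases "subgroup H G")
  case True
  note HG = subgroup.subset[OF True]
  define L :: "nat \<Rightarrow> ('a + nat) set" where "L r = Inl ` H \<union> Inr ` {..<r}" for r
  define R :: "(('a + nat) gword \<times> ('a + nat) gword) set" where
    "R = {([(Inl a, True), (Inl b, True)], [(Inl (a \<otimes> b), True)]) | a b. a \<in> H \<and> b \<in> H}"
  define c where "c r w = pres_rel (L r) R `` {w}" for r w
  have carr: "carrier (free_product_free (G\<lparr>carrier := H\<rparr>) r) = c r ` words (L r)" for r
    by (auto simp: free_product_free_def presented_group_def quotient_def L_def R_def c_def)
  have val: "value_at G (case_sum (\<lambda>h. h) x) (c r w) = word_eval G (case_sum (\<lambda>h. h) x) w"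
    if "w \<in> words (L r)" "x \<in> {..<r} \<rightarrow> carrier G" for r x w
    unfolding c_def
    using that HG by (intro value_at_class) (auto simp: L_def R_def subset_iff m_assoc)
  have all: "(\<forall>E \<subseteq> c r ` words (L r). finite E \<longrightarrow> P E) \<longleftrightarrow>
      (\<forall>E \<subseteq> words (L r). finite E \<longrightarrow> P (c r ` E))" for P r
    by (metis finite_imageI finite_subset_image image_mono)
  have sub: "x \<in> {..<r} \<rightarrow> carrier G" if "x \<in> {..<r::nat} \<rightarrow> H" for x r
    using that HG by auto
  have key: "((\<exists>x \<in> {..<r} \<rightarrow> carrier G. \<forall>W \<in> c r ` E. value_at G (case_sum (\<lambda>h. h) x) W = \<one>) \<longleftrightarrow>
         (\<exists>x \<in> {..<r} \<rightarrow> H. \<forall>W \<in> c r ` E. value_at G (case_sum (\<lambda>h. h) x) W = \<one>)) \<longleftrightarrow>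
      ((\<exists>x \<in> {..<r} \<rightarrow> carrier G. \<forall>w \<in> E. word_eval G (case_sum (\<lambda>h. h) x) w = \<one>) \<longleftrightarrow>
       (\<exists>x \<in> {..<r} \<rightarrow> H. \<forall>w \<in> E. word_eval G (case_sum (\<lambda>h. h) x) w = \<one>))"
    if "E \<subseteq> words (L r)" for r E
  proof -
    have "(\<forall>W \<in> c r ` E. value_at G (case_sum (\<lambda>h. h) x) W = \<one>) \<longleftrightarrow>
        (\<forall>w \<in> E. word_eval G (case_sum (\<lambda>h. h) x) w = \<one>)"
      if "x \<in> {..<r} \<rightarrow> carrier G" for x
      using that \<open>E \<subseteq> words (L r)\<close> val by (auto simp: subset_iff)
    note ev = this
    show ?thesis
      by (intro arg_cong2[of _ _ _ _ "(=)"] bex_cong refl ev) (use sub in auto)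
  qed
  show ?thesis
    unfolding algebraically_closed_in_def carr all L_def[symmetric]
    by (intro conj_cong all_cong1 imp_cong key) (rule HOL.refl)+
qed (simp add: algebraically_closed_in_def)

lemma subgroup_word_eval_image:
  assumes v: "v \<in> S \<rightarrow> carrier G"
  shows "subgroup (word_eval G v ` words S) G"
proof (rule subgroupI)
  show "word_eval G v ` words S \<subseteq> carrier G" using v by auto
  show "word_eval G v ` words S \<noteq> {}" using words_simps(1) by blast
next
  fix a b assume "a \<in> word_eval G v ` words S" "b \<in> word_eval G v ` words S"
  then obtain u w where "u \<in> words S" "w \<in> words S" "a = word_eval G v u" "b = word_eval G v w"
    by auto
  then show "a \<otimes> b \<in> word_eval G v ` words S"
    using word_eval_append[OF v] by (intro image_eqI[of _ _ "u @ w"]) auto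
next
  fix a assume "a \<in> word_eval G v ` words S"
  then obtain w where w: "w \<in> words S" "a = word_eval G v w" by auto
  let ?w = "rev (map (\<lambda>(a, b). (a, \<not> b)) w)"
  have w': "?w \<in> words S"
    using w by (force simp: words_def mem_Times_iff)
  have "word_eval G v ?w \<otimes> word_eval G v w = \<one>"
    using word_eval_pres_rel[OF v _ pres_rel_inverse[OF w(1)], of "{}"]
      word_eval_append[OF v w' w(1)] by simp
  then have "inv a = word_eval G v ?w"
    using w w' v by (intro inv_equality) auto
  then show "inv a \<in> word_eval G v ` words S" using w' by auto
qed

end

lemma word_eval_cong:
  "w \<in> words S \<Longrightarrow> (\<And>a. a \<in> S \<Longrightarrow> v a = v' a) \<Longrightarrow> word_eval G v w = word_eval G v' w"
  by (induction w) auto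

lemma word_eval_map: "word_eval G v (map (map_prod f id) w) = word_eval G (v \<circ> f) w"
  by (induction w) auto

lemma word_eval_hom:
  assumes "group A" "group B" "\<theta> \<in> hom A B" "w \<in> words S" "v \<in> S \<rightarrow> carrier A"
  shows "\<theta> (word_eval A v w) = word_eval B (\<theta> \<circ> v) w"
proof -
  interpret group_hom A B \<theta>
    using assms by (simp add: group_hom_def group_hom_axioms_def)
  show ?thesis
    using assms(4)
  proof (induction w)
    case (Cons p w)
    then have "v (fst p) \<in> carrier A" "word_eval A v w \<in> carrier A"
      using assms(5) by auto
    then show ?case using Cons by simp
  qed simp
qed

text \<open>Groups \<open>G\<close> over an arbitrary type.\<close>

theorem strongly_verbally_closedD:
  fixes H :: "('a, 'b) monoid_scheme" and G :: "('c, 'd) monoid_scheme"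
  assumes svc: "strongly_verbally_closed H" and G: "group G" and \<phi>: "\<phi> \<in> mon H G"
    and vc: "verbally_closed_in (\<phi> ` carrier H) G"
  shows "algebraically_closed_in (\<phi> ` carrier H) G"
proof -
  interpret G: group G by fact
  let ?I = "\<phi> ` carrier H"
  have sub: "subgroup ?I G" using vc by (simp add: verbally_closed_in_def)
  note IG = subgroup.subset[OF sub]
  have "\<exists>y \<in> {..<r} \<rightarrow> ?I. \<forall>w \<in> E. word_eval G (case_sum (\<lambda>h. h) y) w = \<one>\<^bsub>G\<^esub>"
    if E: "E \<subseteq> words (Inl ` ?I \<union> Inr ` {..<r::nat})" "finite E"
      and x: "x \<in> {..<r} \<rightarrow> carrier G" "\<forall>w \<in> E. word_eval G (case_sum (\<lambda>h. h) x) w = \<one>\<^bsub>G\<^esub>"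
    for r E x
  proof -
    define L :: "('a + nat) set" where "L = Inl ` carrier H \<union> Inr ` {..<r}"
    define g where "g = word_eval G (case_sum \<phi> x)"
    define K where "K = g ` words L"
    define f where "f = inv_into (words L) g"
    define G1 where "G1 = G\<lparr>carrier := K\<rparr>"
    define G2 where "G2 = image_group f G1"
    have v: "case_sum \<phi> x \<in> L \<rightarrow> carrier G"
      using IG x by (auto simp: L_def)
    have K: "subgroup K G"
      unfolding K_def g_def by (rule G.subgroup_word_eval_image[OF v])
    have G1: "group G1"
      unfolding G1_def using K by (rule G.subgroup_imp_group)
    have gf: "g (f k) = k" if "k \<in> K" for k
      using that unfolding f_def K_def by (rule f_inv_into_f)
    have inj: "inj_on f (carrier G1)"
      by (rule inj_on_inverseI[of _ g]) (simp add: G1_def gf)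
    have G2: "group G2"
      unfolding G2_def by (rule group.inj_imp_image_group_is_group[OF G1 inj])
    have f: "f \<in> hom G1 G2"
      using inj_imp_image_group_iso[OF inj] by (simp add: G2_def iso_def)
    have carr2: "carrier G2 = f ` K"
      by (simp add: G2_def image_group_carrier G1_def)
    have g: "g \<in> hom G2 G"
    proof (rule homI)
      show "g a \<in> carrier G" if "a \<in> carrier G2" for a
        using that gf subgroup.subset[OF K] by (auto simp: carr2)
      show "g (a \<otimes>\<^bsub>G2\<^esub> b) = g a \<otimes>\<^bsub>G\<^esub> g b" if ab: "a \<in> carrier G2" "b \<in> carrier G2" for a b
      proof -
        obtain k l where kl: "k \<in> K" "a = f k" "l \<in> K" "b = f l"
          using ab by (auto simp: carr2)
        have "a \<otimes>\<^bsub>G2\<^esub> b = f (k \<otimes>\<^bsub>G\<^esub> l)"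
          using hom_mult[OF f, of k l] kl by (simp add: G1_def)
        then show ?thesis using kl gf subgroup.m_closed[OF K] by simp
      qed
    qed
    have gK: "g a \<in> K" if "a \<in> carrier G2" for a
      using that gf by (auto simp: carr2)
    have IK: "?I \<subseteq> K"
    proof
      fix a assume "a \<in> ?I"
      then obtain h where h: "h \<in> carrier H" "a = \<phi> h" by auto
      then have "g [(Inl h, True)] = a" "[(Inl h, True)] \<in> words L"
        using \<open>a \<in> ?I\<close> IG by (auto simp: g_def L_def)
      then show "a \<in> K" unfolding K_def by blast
    qed
    have xK: "x i \<in> K" if "i < r" for i
    proof -
      have "x i \<in> carrier G" using that x by auto
      then have "g [(Inr i, True)] = x i" "[(Inr i, True)] \<in> words L"
        using that by (auto simp: g_def L_def)
      then show ?thesis unfolding K_def by (metis image_eqI)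
    qed
    have incl: "(\<lambda>a. a) \<in> hom G1 G"
      using subgroup.subset[OF K] by (auto simp: hom_def G1_def)
    have eval1: "word_eval G1 z w = word_eval G z w"
      if "w \<in> words S" "z \<in> S \<rightarrow> K" for w z and S :: "'s set"
      using word_eval_hom[OF G1 G incl that(1), of z] that(2) by (simp add: G1_def comp_def)
    have evalf: "word_eval G2 (f \<circ> z) w = f (word_eval G z w)"
      if "w \<in> words S" "z \<in> S \<rightarrow> K" for w z and S :: "'s set"
      using word_eval_hom[OF G1 G2 f that(1), of z] that eval1[OF that] by (simp add: G1_def)
    have evalg: "word_eval G (g \<circ> z) w = g (word_eval G2 z w)"
      if "w \<in> words S" "z \<in> S \<rightarrow> carrier G2" for w z and S :: "'s set"
      using word_eval_hom[OF G2 G g that] by simp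
    define \<psi> where "\<psi> = f \<circ> \<phi>"
    have I2: "\<psi> ` carrier H = f ` ?I" by (auto simp: \<psi>_def)
    have "\<phi> \<in> hom H G1"
      using \<phi> IK by (auto simp: mon_def hom_def G1_def)
    then have "\<psi> \<in> hom H G2"
      unfolding \<psi>_def using f by (metis hom_compose)
    moreover have "inj_on \<psi> (carrier H)"
      unfolding \<psi>_def using \<phi> inj IK by (auto simp: mon_def G1_def intro: comp_inj_on inj_on_subset)
    ultimately have \<psi>: "\<psi> \<in> mon H G2" by (simp add: mon_def)
    have sub2: "subgroup (f ` ?I) G2"
    proof -
      interpret fh: group_hom G1 G2 f
        using G1 G2 f by (simp add: group_hom_def group_hom_axioms_def)
      have "subgroup ?I G1"
        unfolding G1_def by (rule G.subgroup_incl[OF sub K IK])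
      then show ?thesis by (rule fh.subgroup_img_is_subgroup)
    qed
    have fI: "f ` ?I \<subseteq> carrier G2" using subgroup.subset[OF sub2] .
    have "verbally_closed_in (f ` ?I) G2"
      unfolding group.verbally_closed_in_words[OF G2]
    proof (intro conjI allI ballI iffI sub2)
      fix s w h
      assume w: "w \<in> words {..<s::nat}" and h: "h \<in> f ` ?I"
        and "\<exists>y\<in>{..<s} \<rightarrow> carrier G2. word_eval G2 y w = h"
      then obtain y where y: "y \<in> {..<s} \<rightarrow> carrier G2" "word_eval G2 y w = h" by auto
      obtain a where a: "a \<in> ?I" "h = f a" using h by auto
      have "word_eval G (g \<circ> y) w = a"
        using evalg[OF w y(1)] y(2) a IK gf by auto
      moreover have "g \<circ> y \<in> {..<s} \<rightarrow> carrier G"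
        using y gK subgroup.subset[OF K] by (auto simp: Pi_iff)
      ultimately obtain z where z: "z \<in> {..<s} \<rightarrow> ?I" "word_eval G z w = a"
        using vc w a unfolding G.verbally_closed_in_words by blast
      have "word_eval G2 (f \<circ> z) w = h"
        using evalf[OF w, of z] z IK a by (auto simp: Pi_iff)
      moreover have "f \<circ> z \<in> {..<s} \<rightarrow> f ` ?I"
        using z by (auto simp: Pi_iff)
      ultimately show "\<exists>z\<in>{..<s} \<rightarrow> f ` ?I. word_eval G2 z w = h" by blast
    next
      fix s w h
      assume "\<exists>y\<in>{..<s::nat} \<rightarrow> f ` ?I. word_eval G2 y w = h"
      then show "\<exists>y\<in>{..<s} \<rightarrow> carrier G2. word_eval G2 y w = h"
        using fI by blast
    qed
    then have ac: "algebraically_closed_in (f ` ?I) G2"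
      using svc G2 \<psi> unfolding strongly_verbally_closed_def I2[symmetric] by blast
    define m :: "('c + nat) gword \<Rightarrow> (('a + nat) gword + nat) gword" where
      "m = map (map_prod (map_sum f id) id)"
    let ?E = "m ` E"
    have m: "?E \<subseteq> words (Inl ` f ` ?I \<union> Inr ` {..<r})"
    proof -
      have "m w \<in> words (Inl ` f ` ?I \<union> Inr ` {..<r})"
        if "w \<in> words (Inl ` ?I \<union> Inr ` {..<r})" for w
        using that by (induction w) (auto simp: m_def)
      then show ?thesis using E by auto
    qed
    have fs: "f \<circ> x \<in> {..<r} \<rightarrow> carrier G2"
      using xK by (auto simp: carr2)
    have "word_eval G2 (case_sum (\<lambda>h. h) (f \<circ> x)) (m w) = \<one>\<^bsub>G2\<^esub>" if "w \<in> E" for w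
    proof -
      have w: "w \<in> words (Inl ` ?I \<union> Inr ` {..<r})" using that E by auto
      have "word_eval G2 (case_sum (\<lambda>h. h) (f \<circ> x)) (m w) =
          word_eval G2 (f \<circ> case_sum (\<lambda>h. h) x) w"
        unfolding m_def word_eval_map by (rule word_eval_cong[OF w]) auto
      also have "\<dots> = f (word_eval G (case_sum (\<lambda>h. h) x) w)"
        using xK IK by (intro evalf[OF w]) auto
      also have "\<dots> = \<one>\<^bsub>G2\<^esub>"
        using x that hom_one[OF f G1 G2] by (simp add: G1_def)
      finally show ?thesis .
    qed
    then have "\<exists>y \<in> {..<r} \<rightarrow> carrier G2. \<forall>w \<in> ?E. word_eval G2 (case_sum (\<lambda>h. h) y) w = \<one>\<^bsub>G2\<^esub>"
      using fs by blast
    moreover have "(\<exists>y \<in> {..<r} \<rightarrow> carrier G2. \<forall>w \<in> ?E. word_eval G2 (case_sum (\<lambda>h. h) y) w = \<one>\<^bsub>G2\<^esub>)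
        \<longleftrightarrow> (\<exists>y \<in> {..<r} \<rightarrow> f ` ?I. \<forall>w \<in> ?E. word_eval G2 (case_sum (\<lambda>h. h) y) w = \<one>\<^bsub>G2\<^esub>)"
      using ac[unfolded group.algebraically_closed_in_words[OF G2]] m finite_imageI[OF E(2)]
      by (elim conjE allE impE) assumption+
    ultimately obtain y where y: "y \<in> {..<r} \<rightarrow> f ` ?I"
      "\<forall>w \<in> ?E. word_eval G2 (case_sum (\<lambda>h. h) y) w = \<one>\<^bsub>G2\<^esub>"
      by blast
    have yG2: "y \<in> {..<r} \<rightarrow> carrier G2" using y(1) fI by blast
    have "word_eval G (case_sum (\<lambda>h. h) (g \<circ> y)) w = \<one>\<^bsub>G\<^esub>" if "w \<in> E" for w
    proof -
      have w: "w \<in> words (Inl ` ?I \<union> Inr ` {..<r})" using that E by auto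
      have "word_eval G (case_sum (\<lambda>h. h) (g \<circ> y)) w =
          word_eval G (g \<circ> case_sum (\<lambda>h. h) y) (m w)"
        unfolding m_def word_eval_map using gf IK by (intro word_eval_cong[OF w]) auto
      also have "\<dots> = g (word_eval G2 (case_sum (\<lambda>h. h) y) (m w))"
        using m that yG2 fI by (intro evalg[of _ "Inl ` f ` ?I \<union> Inr ` {..<r}"]) auto
      also have "\<dots> = \<one>\<^bsub>G\<^esub>"
        using y that hom_one[OF g G2 G] by simp
      finally show ?thesis .
    qed
    moreover have "g \<circ> y \<in> {..<r} \<rightarrow> ?I"
    proof
      fix i assume "i \<in> {..<r}"
      then have "y i \<in> f ` ?I" using y by auto
      then show "(g \<circ> y) i \<in> ?I" using gf IK by (force simp: subset_iff)
    qed
    ultimately show ?thesis by blast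
  qed
  note solvable = this
  show ?thesis
    unfolding G.algebraically_closed_in_words
  proof (intro conjI allI impI iffI sub)
    fix r E
    assume "E \<subseteq> words (Inl ` ?I \<union> Inr ` {..<r::nat})" "finite E"
      and "\<exists>x\<in>{..<r} \<rightarrow> carrier G. \<forall>w\<in>E. word_eval G (case_sum (\<lambda>h. h) x) w = \<one>\<^bsub>G\<^esub>"
    then show "\<exists>x\<in>{..<r} \<rightarrow> ?I. \<forall>w\<in>E. word_eval G (case_sum (\<lambda>h. h) x) w = \<one>\<^bsub>G\<^esub>"
      using solvable by (elim bexE) metis
  next
    fix r E
    assume "\<exists>x\<in>{..<r::nat} \<rightarrow> ?I. \<forall>w\<in>E. word_eval G (case_sum (\<lambda>h. h) x) w = \<one>\<^bsub>G\<^esub>"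
    then obtain x where x: "x \<in> {..<r} \<rightarrow> ?I"
      "\<forall>w\<in>E. word_eval G (case_sum (\<lambda>h. h) x) w = \<one>\<^bsub>G\<^esub>" by (elim bexE)
    then have "x \<in> {..<r} \<rightarrow> carrier G" using IG by blast
    with x(2) show "\<exists>x\<in>{..<r} \<rightarrow> carrier G. \<forall>w\<in>E. word_eval G (case_sum (\<lambda>h. h) x) w = \<one>\<^bsub>G\<^esub>"
      by (rule bexI)
  qed
qed

end

theory Submission
  imports Defs
begin

text \<open>
  Let \<open>d \<in> H\<close> have a central square \<open>z\<close>. The overgroup refuting strong verbal closedness consists
  of triples over \<open>H\<close>, where \<open>(z, 1, 1)\<close>, \<open>(1, z, 1)\<close> and \<open>(1, 1, z\<^sup>-\<^sup>1)\<close> are identified; \<open>H\<close> embeds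
  diagonally. A solution of \<open>w = h\<close> there gives \<open>w(u\<^sub>j) = h z\<^bsup>s\<^sub>j\<^esup>\<close> in \<open>H\<close> for \<open>j = 0, 1, 2\<close> with
  \<open>s\<^sub>2 = s\<^sub>0 + s\<^sub>1\<close>, and multiplying the unknowns by powers of \<open>z\<close> changes each \<open>s\<^sub>j\<close> by an arbitrary
  element of a subgroup \<open>D\<close> of the integers. If a homomorphism \<open>e\<close> to the integers takes congruent
  values modulo \<open>e d\<close> on the components of the triples, then \<open>2 (s\<^sub>i - s\<^sub>j) \<in> D\<close>, hence \<open>2 s\<^sub>j \<in> D\<close>,
  and one of \<open>s\<^sub>0\<close>, \<open>s\<^sub>1\<close>, \<open>s\<^sub>0 + s\<^sub>1\<close> lies in \<open>D\<close>: so \<open>H\<close> is verbally closed.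

  In the overgroup \<open>x = (d, 1, 1)\<close> and \<open>y = (1, d, 1)\<close> are square roots of \<open>z\<close>, and all conjugates of
  \<open>x\<close> by \<open>H\<close> commute with \<open>y\<close>. In \<open>SL\<^sub>n(\<int>)\<close>, with \<open>z = -1\<close>, this is impossible. In the braid group,
  with \<open>d\<close> the half twist, the linking numbers show that no pure braid is a square root of the full
  twist, so \<open>x\<close> and \<open>y\<close> induce nontrivial involutions in the symmetric group. Splitting
  \<open>g = \<sigma>\<^sub>1 \<sigma>\<^sub>2\<^sup>-\<^sup>1\<close> as \<open>(g, 1, 1) (1, g, 1) (1, 1, g)\<close>, each factor commutes with all conjugates of \<open>x\<close> or
  of \<open>y\<close> and therefore induces an involution; so would their product, but it induces a 3-cycle.
\<close>

section \<open>Gluing three copies of a group along a central square\<close>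

definition letter_sum :: "('a \<Rightarrow> int) \<Rightarrow> 'a gword \<Rightarrow> int" where
  "letter_sum c w = (\<Sum>(a, b)\<leftarrow>w. if b then c a else - c a)"

lemma letter_sum_simps [simp]:
  "letter_sum c [] = 0"
  "letter_sum c (p # w) = (if snd p then c (fst p) else - c (fst p)) + letter_sum c w"
  by (auto simp: letter_sum_def split: prod.splits)

lemma letter_sum_diff: "letter_sum (\<lambda>a. c a - c' a) w = letter_sum c w - letter_sum c' w"
  by (induction w) auto

lemma letter_sum_scale: "letter_sum (\<lambda>a. k * c a) w = k * letter_sum c w"
  by (induction w) (auto simp: algebra_simps)

lemma letter_sum_cong:
  "w \<in> words S \<Longrightarrow> (\<And>a. a \<in> S \<Longrightarrow> c a = c' a) \<Longrightarrow> letter_sum c w = letter_sum c' w"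
  by (induction w) auto

lemma (in group) int_pow_central:
  assumes "z \<in> carrier G" "h \<in> carrier G" "h \<otimes> z = z \<otimes> h"
  shows "h \<otimes> z [^] (k::int) = z [^] k \<otimes> h"
proof -
  have "inv h \<otimes> z \<otimes> h = z"
    using assms by (metis inv_closed inv_solve_left m_assoc m_closed)
  interpret c: group_hom G G "\<lambda>x. inv h \<otimes> x \<otimes> h"
  proof unfold_locales
    show "(\<lambda>x. inv h \<otimes> x \<otimes> h) \<in> hom G G"
      using assms(2) by (auto intro!: homI simp: m_assoc) (simp flip: m_assoc)
  qed
  have "inv h \<otimes> z [^] k \<otimes> h = z [^] k"
    using c.hom_int_pow[OF assms(1), of k] \<open>inv h \<otimes> z \<otimes> h = z\<close> by simp
  then show ?thesis
    using assms by (metis int_pow_closed inv_closed inv_solve_left m_assoc m_closed)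
qed

text \<open>Central factors can be collected at the end of the word. As \<open>c\<close> varies, the
  exponents \<open>letter_sum c w\<close> are the corrections to the value of \<open>w\<close> that
  shifting the unknowns by powers of \<open>z\<close> can achieve.\<close>

lemma (in group) word_eval_mult_central:
  assumes z: "z \<in> carrier G" "\<And>h. h \<in> carrier G \<Longrightarrow> h \<otimes> z = z \<otimes> h"
    and "w \<in> words S" "v \<in> S \<rightarrow> carrier G"
  shows "word_eval G (\<lambda>a. v a \<otimes> z [^] (c a :: int)) w = word_eval G v w \<otimes> z [^] letter_sum c w"
  using assms(3)
proof (induction w)
  case Nil
  then show ?case by simp
next
  case (Cons p w)
  obtain a b where p: "p = (a, b)" by (cases p)
  have v: "v a \<in> carrier G" and W: "word_eval G v w \<in> carrier G"
    using Cons assms(4) p by auto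
  have comm: "h \<otimes> z [^] (k::int) = z [^] k \<otimes> h" if "h \<in> carrier G" for h k
    using int_pow_central z that by blast
  define g where "g = (if b then v a else inv v a)"
  define k where "k = (if b then c a else - c a)"
  have g: "g \<in> carrier G" using v by (simp add: g_def)
  have "inv (v a \<otimes> z [^] c a) = inv v a \<otimes> z [^] (- c a)"
    using v z(1) comm[of "inv v a" "- c a"] by (simp add: inv_mult_group int_pow_neg)
  then have "word_eval G (\<lambda>a. v a \<otimes> z [^] c a) (p # w) =
      (g \<otimes> z [^] k) \<otimes> (word_eval G v w \<otimes> z [^] letter_sum c w)"
    using Cons p by (simp add: g_def k_def)
  also have "\<dots> = g \<otimes> (z [^] k \<otimes> word_eval G v w) \<otimes> z [^] letter_sum c w"
    using g z(1) W by (simp add: m_assoc)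
  also have "z [^] k \<otimes> word_eval G v w = word_eval G v w \<otimes> z [^] k"
    using comm W by simp
  also have "g \<otimes> (word_eval G v w \<otimes> z [^] k) \<otimes> z [^] letter_sum c w =
      (g \<otimes> word_eval G v w) \<otimes> z [^] (k + letter_sum c w)"
    using g z(1) W by (simp add: m_assoc int_pow_mult)
  finally show ?case by (simp add: p g_def k_def)
qed

text \<open>This is why three copies are glued. \<open>D\<close> is closed under integer
  combinations and so contains twice the gcd of \<open>a\<close> and \<open>b\<close>; of the
  quotients of \<open>a\<close> and \<open>b\<close> by the gcd and the sum of these quotients, at
  least one is even.\<close>

lemma int_halving:
  fixes D :: "int set"
  assumes diff: "\<And>s t. s \<in> D \<Longrightarrow> t \<in> D \<Longrightarrow> s - t \<in> D"
    and ab: "2 * a \<in> D" "2 * b \<in> D"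
  shows "a \<in> D \<or> b \<in> D \<or> a + b \<in> D"
proof (cases "a = 0 \<and> b = 0")
  case True
  then show ?thesis using ab by auto
next
  case False
  have zero: "0 \<in> D" using diff[OF ab(1) ab(1)] by simp
  have uminus: "- s \<in> D" if "s \<in> D" for s using diff[OF zero that] by simp
  have add: "s + t \<in> D" if "s \<in> D" "t \<in> D" for s t
    using diff[OF that(1) uminus[OF that(2)]] by simp
  have nmult: "int k * s \<in> D" if "s \<in> D" for k s
    by (induction k) (use that zero add in \<open>auto simp: algebra_simps\<close>)
  have mult: "k * s \<in> D" if "s \<in> D" for k s
    using nmult[OF that, of "nat k"] nmult[OF uminus[OF that], of "nat (- k)"]
    by (cases "k \<ge> 0") auto
  define g where "g = gcd a b"
  obtain u v where "u * a + v * b = g"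
    unfolding g_def by (metis bezout_int)
  then have "2 * g = u * (2 * a) + v * (2 * b)" by (auto simp: algebra_simps)
  then have g: "2 * g \<in> D" using add mult ab by metis
  obtain a' b' where a': "a = g * a'" and b': "b = g * b'"
    unfolding g_def by (meson dvdE gcd_dvd1 gcd_dvd2)
  have even_mult: "g * k \<in> D" if "even k" for k
    using that mult[OF g] by (auto elim!: evenE simp: algebra_simps)
  consider "even a'" | "even b'" | "even (a' + b')" by auto
  then show ?thesis
    by cases (use even_mult in \<open>auto simp: a' b' simp flip: distrib_left\<close>)
qed

section \<open>Commuting conjugates as word equations\<close>

definition (in group) conj_commute :: "'a \<Rightarrow> 'a \<Rightarrow> 'a \<Rightarrow> bool" where
  "conj_commute h a b \<longleftrightarrow> (h \<otimes> a \<otimes> inv h) \<otimes> b = b \<otimes> (h \<otimes> a \<otimes> inv h)"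

text \<open>The word is the commutator of \<open>h \<otimes> a \<otimes> inv h\<close> and
  \<open>b\<close>. The letter type is left open, so that in \<open>commuting_system\<close> the
  letter of \<open>h\<close> is a coefficient and those of \<open>a\<close> and \<open>b\<close> are
  unknowns.\<close>

lemma (in group) conj_commute_iff_word_eval:
  assumes "v (fst p) = h" "v (fst s) = a" "v (fst t) = b" "snd p" "snd s" "snd t"
    and "h \<in> carrier G" "a \<in> carrier G" "b \<in> carrier G"
  shows "word_eval G v [p, s, (fst p, False), t, p, (fst s, False), (fst p, False), (fst t, False)] = \<one>
    \<longleftrightarrow> conj_commute h a b"
proof -
  define c where "c = h \<otimes> a \<otimes> inv h"
  have c: "c \<in> carrier G" using assms by (simp add: c_def)
  have "inv c = h \<otimes> inv a \<otimes> inv h"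
    using assms by (simp add: c_def inv_mult_group m_assoc)
  then have "word_eval G v [p, s, (fst p, False), t, p, (fst s, False), (fst p, False), (fst t, False)]
      = c \<otimes> b \<otimes> inv (b \<otimes> c)"
    using assms c by (simp add: c_def inv_mult_group m_assoc)
  then show ?thesis
    using assms c by (metis c_def conj_commute_def inv_closed inv_equality inv_inv m_closed r_inv)
qed

text \<open>The equations \<open>x\<^sub>0\<^sup>2 = z\<close>, \<open>x\<^sub>1\<^sup>2 = z\<close>, \<open>x\<^sub>3 x\<^sub>4 x\<^sub>2 = g\<close>, and \<open>h x\<^sub>i h\<^sup>-\<^sup>1\<close> commutes with \<open>x\<^sub>j\<close>
  if \<open>i\<close> and \<open>j\<close> differ modulo 3.\<close>

definition commuting_system :: "'g \<Rightarrow> 'g \<Rightarrow> 'g set \<Rightarrow> ('g + nat) gword set" where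
  "commuting_system z g E =
    {[(Inr 0, True), (Inr 0, True), (Inl z, False)],
     [(Inr 1, True), (Inr 1, True), (Inl z, False)],
     [(Inr 3, True), (Inr 4, True), (Inr 2, True), (Inl g, False)]} \<union>
    (\<lambda>(h, i, j). [(Inl h, True), (Inr i, True), (Inl h, False), (Inr j, True),
      (Inl h, True), (Inr i, False), (Inl h, False), (Inr j, False)]) `
      (E \<times> {(i, j) \<in> {..<5} \<times> {..<5}. i mod 3 \<noteq> j mod 3})"

lemma finite_commuting_system: "finite E \<Longrightarrow> finite (commuting_system z g E)"
proof -
  have "finite {(i, j) \<in> {..<5} \<times> {..<5}. i mod 3 \<noteq> j mod (3::nat)}"
    by (rule finite_subset[of _ "{..<5} \<times> {..<5}"]) auto
  then show "finite E \<Longrightarrow> ?thesis" by (simp add: commuting_system_def)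
qed

lemma commuting_system_words:
  "z \<in> S \<Longrightarrow> g \<in> S \<Longrightarrow> E \<subseteq> S \<Longrightarrow> commuting_system z g E \<subseteq> words (Inl ` S \<union> Inr ` {..<5})"
  by (auto simp: commuting_system_def)

lemma (in group) commuting_system_iff:
  assumes "z \<in> carrier G" "g \<in> carrier G" "E \<subseteq> carrier G" and x: "x \<in> {..<5} \<rightarrow> carrier G"
  shows "(\<forall>w\<in>commuting_system z g E. word_eval G (case_sum (\<lambda>h. h) x) w = \<one>) \<longleftrightarrow>
    x 0 \<otimes> x 0 = z \<and> x 1 \<otimes> x 1 = z \<and> x 3 \<otimes> x 4 \<otimes> x 2 = g \<and>
    (\<forall>h\<in>E. \<forall>i<5. \<forall>j<5. i mod 3 \<noteq> j mod 3 \<longrightarrow> conj_commute h (x i) (x j))"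
proof -
  have xi: "x i \<in> carrier G" if "i < 5" for i using x that by auto
  have eq: "a \<otimes> inv b = \<one> \<longleftrightarrow> a = b" if "a \<in> carrier G" "b \<in> carrier G" for a b
    using that by (metis inv_closed inv_equality inv_inv r_inv)
  have sq: "word_eval G (case_sum (\<lambda>h. h) x) [(Inr i, True), (Inr i, True), (Inl z, False)] = \<one>
      \<longleftrightarrow> x i \<otimes> x i = z" if "i < 5" for i
    using eq[of "x i \<otimes> x i" z] xi[OF that] assms(1) by (simp add: m_assoc)
  have tr: "word_eval G (case_sum (\<lambda>h. h) x) [(Inr 3, True), (Inr 4, True), (Inr 2, True), (Inl g, False)] = \<one>
      \<longleftrightarrow> x 3 \<otimes> x 4 \<otimes> x 2 = g"
    using eq[of "x 3 \<otimes> x 4 \<otimes> x 2" g] xi[of 2] xi[of 3] xi[of 4] assms(2) by (simp add: m_assoc)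
  have cm: "word_eval G (case_sum (\<lambda>h. h) x) [(Inl h, True), (Inr i, True), (Inl h, False), (Inr j, True),
      (Inl h, True), (Inr i, False), (Inl h, False), (Inr j, False)] = \<one>
      \<longleftrightarrow> conj_commute h (x i) (x j)" if "h \<in> E" "i < 5" "j < 5" for h i j
    using conj_commute_iff_word_eval[of "case_sum (\<lambda>h. h) x" "(Inl h, True)" h "(Inr i, True)" "x i" "(Inr j, True)" "x j"]
      that xi assms(3) by auto
  show ?thesis
    using sq[of 0] sq[of 1] tr
    by (auto simp: commuting_system_def ball_Un cm simp del: word_eval_Cons)
qed

section \<open>Correcting defects by central shifts\<close>

text \<open>Covers both families: in braid groups \<open>d\<close> is the half twist and
  \<open>e\<close> the exponent sum, with \<open>e d\<close> nonzero; in \<open>SL_int n\<close> the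
  map \<open>e\<close> is zero and the square of \<open>d\<close> is -1. Either alternative of
  \<open>e_d\<close> makes doubled differences of defects correctable.\<close>

locale square_root_of_center = group +
  fixes d :: 'a and e :: "'a \<Rightarrow> int"
  assumes d [simp]: "d \<in> carrier G"
    and central: "\<And>h. h \<in> carrier G \<Longrightarrow> h \<otimes> (d \<otimes> d) = (d \<otimes> d) \<otimes> h"
    and e_mult: "\<And>a b. a \<in> carrier G \<Longrightarrow> b \<in> carrier G \<Longrightarrow> e (a \<otimes> b) = e a + e b"
    and e_d: "e d \<noteq> 0 \<or> (d \<otimes> d) \<otimes> (d \<otimes> d) = \<one>"
begin

abbreviation z where "z \<equiv> d \<otimes> d"

lemma z_pow_comm: "h \<in> carrier G \<Longrightarrow> h \<otimes> z [^] (k::int) = z [^] k \<otimes> h"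
  using int_pow_central central by simp

lemma e_one: "e \<one> = 0"
  using e_mult[of \<one> \<one>] by simp

lemma e_inv: "a \<in> carrier G \<Longrightarrow> e (inv a) = - e a"
  using e_mult[of a "inv a"] by (simp add: e_one)

lemma e_z_pow: "e (z [^] (k::int)) = 2 * e d * k"
proof -
  have nat: "e (z [^] n) = 2 * e d * int n" for n :: nat
    by (induction n) (auto simp: e_one e_mult algebra_simps)
  show ?thesis
  proof (cases "k \<ge> 0")
    case True
    then show ?thesis using nat[of "nat k"] by (simp flip: int_pow_int)
  next
    case False
    then show ?thesis
      using nat[of "nat (- k)"] int_pow_neg_int[of z "nat (- k)"] by (simp add: e_inv)
  qed
qed

lemma e_word_eval:
  "w \<in> words S \<Longrightarrow> v \<in> S \<rightarrow> carrier G \<Longrightarrow> e (word_eval G v w) = letter_sum (e \<circ> v) w"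
proof (induction w)
  case (Cons p w)
  then have "v (fst p) \<in> carrier G" "word_eval G v w \<in> carrier G" by auto
  then show ?case using Cons by (simp add: e_mult e_inv)
qed (simp add: e_one)

text \<open>Each \<open>u j\<close> solves the equation up to the defect \<open>s j\<close>.
  Comparing two of them under \<open>e\<close> shows that twice the difference of their defects can
  be absorbed by a central shift. As the defects satisfy \<open>sum\<close>,
  \<open>int_halving\<close> finds one that can itself be absorbed.\<close>

lemma solution_by_central_shift:
  fixes u :: "nat \<Rightarrow> 'c \<Rightarrow> 'a"
  assumes w: "w \<in> words S" and h: "h \<in> carrier G"
    and u: "\<And>j. j < 3 \<Longrightarrow> u j \<in> S \<rightarrow> carrier G"
    and cong: "\<And>i j a. i < 3 \<Longrightarrow> j < 3 \<Longrightarrow> a \<in> S \<Longrightarrow> e d dvd e (u i a) - e (u j a)"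
    and s: "\<And>j. j < 3 \<Longrightarrow> word_eval G (u j) w = h \<otimes> z [^] (s j :: int)"
    and sum: "s 2 = s 0 + s 1"
  shows "\<exists>v \<in> S \<rightarrow> carrier G. word_eval G v w = h"
proof -
  \<comment> \<open>\<open>D\<close> compares powers of \<open>z\<close> rather than exponents
    because \<open>z\<close> may have finite order.\<close>
  define D where "D = {k :: int. \<exists>c. z [^] k = z [^] letter_sum c w}"
  have diff: "k - l \<in> D" if kl: "k \<in> D" "l \<in> D" for k l
  proof -
    obtain c c' where "z [^] k = z [^] letter_sum c w" "z [^] l = z [^] letter_sum c' w"
      using kl by (auto simp: D_def)
    then have "z [^] (k - l) = z [^] letter_sum (\<lambda>a. c a - c' a) w"
      by (simp add: int_pow_diff letter_sum_diff)
    then show ?thesis by (auto simp: D_def)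
  qed
  have twice: "2 * (s i - s j) \<in> D" if ij: "i < 3" "j < 3" for i j
  proof (cases "e d = 0")
    \<comment> \<open>Here the square of \<open>z\<close> is trivial, so the zero shift realises
      every even exponent.\<close>
    case True
    then have "z [^] (2 * (s i - s j)) = (z [^] (2::int)) [^] (s i - s j)"
      by (simp add: int_pow_pow)
    also have "z [^] (2::int) = \<one>"
      using e_d True int_pow_mult[of z 1 1] by simp
    finally have "z [^] (2 * (s i - s j)) = z [^] letter_sum (\<lambda>_. 0) w"
      using letter_sum_scale[of 0 "\<lambda>_. 0" w] by simp
    then show ?thesis by (auto simp: D_def)
  next
    case False
    \<comment> \<open>The congruences make this division exact. Summed along \<open>w\<close>, the
      multiples \<open>e d * c a\<close> give the difference of the two values under
      \<open>e\<close>, which is \<open>2 * e d * (s i - s j)\<close>.\<close>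
    define c where "c a = (e (u i a) - e (u j a)) div e d" for a
    have eu: "letter_sum (e \<circ> u k) w = e h + 2 * e d * s k" if "k < 3" for k
      using e_word_eval[OF w u[OF that]] s[OF that] h by (simp add: e_mult e_z_pow)
    have "e d * letter_sum c w = letter_sum (\<lambda>a. e d * c a) w"
      by (simp add: letter_sum_scale)
    also have "\<dots> = letter_sum (\<lambda>a. (e \<circ> u i) a - (e \<circ> u j) a) w"
      using cong[OF ij] by (intro letter_sum_cong[OF w]) (simp add: c_def)
    also have "\<dots> = letter_sum (e \<circ> u i) w - letter_sum (e \<circ> u j) w"
      by (rule letter_sum_diff)
    also have "\<dots> = e d * (2 * (s i - s j))"
      unfolding eu[OF ij(1)] eu[OF ij(2)] by (simp add: algebra_simps)
    finally have "letter_sum c w = 2 * (s i - s j)" using False by simp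
    then have "z [^] (2 * (s i - s j)) = z [^] letter_sum c w" by (simp only:)
    then show ?thesis unfolding D_def by blast
  qed
  \<comment> \<open>By \<open>sum\<close>, \<open>s 2 - s 1\<close> is \<open>s 0\<close> and
    \<open>s 2 - s 0\<close> is \<open>s 1\<close>.\<close>
  have "2 * s 0 \<in> D" "2 * s 1 \<in> D"
    using twice[of 2 1] twice[of 2 0] sum by simp_all
  then have "s 0 \<in> D \<or> s 1 \<in> D \<or> s 2 \<in> D"
    unfolding sum using int_halving[of D "s 0" "s 1"] diff by blast
  moreover have "(0::nat) < 3" "(1::nat) < 3" "(2::nat) < 3" by simp_all
  ultimately obtain j where j: "j < 3" "s j \<in> D" by blast
  then obtain c where c: "z [^] s j = z [^] letter_sum c w"
    by (auto simp: D_def)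
  let ?v = "\<lambda>a. u j a \<otimes> z [^] ((-1) * c a)"
  have "word_eval G ?v w = word_eval G (u j) w \<otimes> z [^] letter_sum (\<lambda>a. (-1) * c a) w"
    by (rule word_eval_mult_central[OF _ central w u[OF j(1)]]) simp_all
  also have "\<dots> = h \<otimes> (z [^] s j \<otimes> inv (z [^] s j))"
    unfolding letter_sum_scale s[OF j(1)] using h c by (simp add: int_pow_neg m_assoc)
  also have "\<dots> = h" using h by simp
  finally have "word_eval G ?v w = h" .
  moreover have "?v \<in> S \<rightarrow> carrier G" using u[OF j(1)] by auto
  ultimately show ?thesis by blast
qed

section \<open>The overgroup and the diagonal copy of the group\<close>

text \<open>The congruences are those that \<open>solution_by_central_shift\<close> asks for, and
  they still admit \<open>(d, \<one>, \<one>)\<close>. For \<open>e d = 0\<close> divisibility means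
  equality, which holds trivially when \<open>e\<close> is zero everywhere.\<close>

definition triples :: "('a \<times> 'a \<times> 'a) monoid" where
  "triples = \<lparr> carrier = {(a, b, c). a \<in> carrier G \<and> b \<in> carrier G \<and> c \<in> carrier G \<and>
      e d dvd e a - e b \<and> e d dvd e a - e c},
    monoid.mult = (\<lambda>(a, b, c) (a', b', c'). (a \<otimes> a', b \<otimes> b', c \<otimes> c')),
    one = (\<one>, \<one>, \<one>) \<rparr>"

text \<open>Generated by \<open>(z, \<one>, z)\<close> and \<open>(\<one>, z, z)\<close>. Modulo it
  \<open>(z, z, z)\<close> agrees with both \<open>(z, \<one>, \<one>)\<close> and
  \<open>(\<one>, z, \<one>)\<close>, so these represent the diagonal image of
  \<open>z\<close>.\<close>

definition glue :: "('a \<times> 'a \<times> 'a) set" where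
  "glue = {(z [^] s, z [^] t, z [^] (s + t)) | s t :: int. True}"

lemma triples_simps [simp]:
  "(a, b, c) \<in> carrier triples \<longleftrightarrow> a \<in> carrier G \<and> b \<in> carrier G \<and> c \<in> carrier G \<and>
      e d dvd e a - e b \<and> e d dvd e a - e c"
  "(a, b, c) \<otimes>\<^bsub>triples\<^esub> (a', b', c') = (a \<otimes> a', b \<otimes> b', c \<otimes> c')"
  "\<one>\<^bsub>triples\<^esub> = (\<one>, \<one>, \<one>)"
  by (auto simp: triples_def)

lemma dvd_diff_add: "k dvd a - b \<Longrightarrow> k dvd a' - b' \<Longrightarrow> k dvd (a + a') - (b + b')" for k :: int
  by (metis add_diff_add dvd_add)

lemma group_triples: "group triples"
proof (rule groupI)
  fix x assume "x \<in> carrier triples"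
  then obtain a b c where x: "x = (a, b, c)" "(a, b, c) \<in> carrier triples" by (cases x) auto
  then show "\<one>\<^bsub>triples\<^esub> \<otimes>\<^bsub>triples\<^esub> x = x" by simp
  have "e d dvd - (e a - e b)" "e d dvd - (e a - e c)" using x(2) by (simp_all only: dvd_minus_iff triples_simps)
  then show "\<exists>y\<in>carrier triples. y \<otimes>\<^bsub>triples\<^esub> x = \<one>\<^bsub>triples\<^esub>"
    using x by (intro bexI[of _ "(inv a, inv b, inv c)"]) (auto simp: e_inv)
qed (auto simp: m_assoc e_mult dvd_diff_add)

lemma inv_triples:
  assumes "(a, b, c) \<in> carrier triples"
  shows "inv\<^bsub>triples\<^esub> (a, b, c) = (inv a, inv b, inv c)"
proof (rule group.inv_equality[OF group_triples])
  have "e d dvd - (e a - e b)" "e d dvd - (e a - e c)" using assms by (simp_all only: dvd_minus_iff triples_simps)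
  then show "(inv a, inv b, inv c) \<in> carrier triples"
    using assms by (auto simp: e_inv)
qed (use assms in auto)

lemma normal_glue: "glue \<lhd> triples"
proof -
  have in_glue: "(z [^] s, z [^] t, z [^] (s + t)) \<in> glue" for s t :: int
    unfolding glue_def by blast
  have carr: "(z [^] s, z [^] t, z [^] (s + t)) \<in> carrier triples" for s t :: int
    by (auto simp: e_z_pow simp flip: right_diff_distrib)
  have sub: "subgroup glue triples"
  proof (rule group.subgroupI[OF group_triples])
    show "glue \<subseteq> carrier triples" "glue \<noteq> {}"
      using carr unfolding glue_def by blast+
    show "inv\<^bsub>triples\<^esub> x \<in> glue" if x_in: "x \<in> glue" for x
    proof -
      obtain s t :: int where x: "x = (z [^] s, z [^] t, z [^] (s + t))"
        using x_in unfolding glue_def by blast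
      then show ?thesis
        using in_glue[of "- s" "- t"] by (simp add: inv_triples[OF carr] flip: int_pow_neg)
    qed
    show "x \<otimes>\<^bsub>triples\<^esub> y \<in> glue" if xy_in: "x \<in> glue" "y \<in> glue" for x y
    proof -
      obtain s t s' t' :: int where xy: "x = (z [^] s, z [^] t, z [^] (s + t))"
          "y = (z [^] s', z [^] t', z [^] (s' + t'))"
        using xy_in unfolding glue_def by blast
      then show ?thesis
        using in_glue[of "s + s'" "t + t'"] by (simp add: int_pow_mult[symmetric] algebra_simps)
    qed
  qed
  show ?thesis
  proof (rule group.normalI[OF group_triples sub], rule ballI)
    fix x assume "x \<in> carrier triples"
    then show "glue #>\<^bsub>triples\<^esub> x = x <#\<^bsub>triples\<^esub> glue"
      by (cases x) (auto simp: r_coset_def l_coset_def glue_def z_pow_comm intro!: exI)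
  qed
qed

abbreviation "amalgam \<equiv> triples Mod glue"
abbreviation coset_map ("\<pi>") where "\<pi> t \<equiv> glue #>\<^bsub>triples\<^esub> t"
abbreviation diagonal ("\<Delta>") where "\<Delta> h \<equiv> \<pi> (h, h, h)"

lemma group_amalgam: "group amalgam"
  using normal.factorgroup_is_group[OF normal_glue] .

lemma coset_map_hom: "\<pi> \<in> hom triples amalgam"
  using normal.r_coset_hom_Mod[OF normal_glue] .

lemma coset_map_eqD:
  assumes "t \<in> carrier triples" "(a, b, c) \<in> carrier triples" "\<pi> t = \<pi> (a, b, c)"
  shows "\<exists>k l :: int. t = (z [^] k \<otimes> a, z [^] l \<otimes> b, z [^] (k + l) \<otimes> c)"
proof -
  have "t \<in> \<pi> (a, b, c)"
    using group.rcos_self[OF group_triples assms(1)] normal_glue assms(3) by (metis normal_def)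
  then show ?thesis by (auto simp: r_coset_def glue_def)
qed

lemma coset_map_glue:
  fixes k l :: int
  assumes "(a, b, c) \<in> carrier triples"
  shows "\<pi> (z [^] k \<otimes> a, z [^] l \<otimes> b, z [^] (k + l) \<otimes> c) = \<pi> (a, b, c)"
proof -
  have "(z [^] k, z [^] l, z [^] (k + l)) \<otimes>\<^bsub>triples\<^esub> (a, b, c) \<in> \<pi> (a, b, c)"
    unfolding r_coset_def glue_def by blast
  then show ?thesis
    using group.repr_independence[OF group_triples _ assms] normal_glue by (simp add: normal_def)
qed

lemma diagonal_mon: "\<Delta> \<in> mon G amalgam"
proof -
  have "(\<lambda>h. (h, h, h)) \<in> hom G triples"
    by (auto intro!: homI)
  then have "\<Delta> \<in> hom G amalgam"
    using Group.hom_compose[OF _ coset_map_hom] by (simp add: comp_def)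
  moreover have "inj_on \<Delta> (carrier G)"
  proof
    fix h h' assume h: "h \<in> carrier G" "h' \<in> carrier G" and "\<Delta> h = \<Delta> h'"
    have "(h, h, h) \<in> carrier triples" "(h', h', h') \<in> carrier triples"
      using h by simp_all
    then have "\<exists>s t :: int. (h, h, h) = (z [^] s \<otimes> h', z [^] t \<otimes> h', z [^] (s + t) \<otimes> h')"
      by (rule coset_map_eqD) fact
    then obtain s t :: int where
      h_eq: "h = z [^] s \<otimes> h'" "h = z [^] t \<otimes> h'" "h = z [^] (s + t) \<otimes> h'"
      by blast
    have "z [^] s \<otimes> h' = z [^] t \<otimes> h'" "z [^] s \<otimes> h' = z [^] (s + t) \<otimes> h'"
      by (rule HOL.trans[OF h_eq(1)[symmetric] h_eq(2)], rule HOL.trans[OF h_eq(1)[symmetric] h_eq(3)])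
    \<comment> \<open>After cancelling \<open>h'\<close>, the first and third components make
      \<open>z [^] t\<close> trivial, and the first two carry this over to \<open>z [^] s\<close>.
      The exponents themselves may be nonzero.\<close>
    then have st: "z [^] s = z [^] t" "z [^] s = z [^] s \<otimes> z [^] t"
      using h by (simp_all add: int_pow_mult r_cancel)
    then have "z [^] s = \<one>"
      by (metis d int_pow_closed m_closed r_cancel_one')
    then show "h = h'" using h_eq(1) h by simp
  qed
  ultimately show ?thesis by (simp add: mon_def)
qed

lemma carrier_amalgam: "carrier amalgam = \<pi> ` carrier triples"
  by (auto simp: FactGroup_def RCOSETS_def)

text \<open>A solution in the quotient lifts to \<open>triples\<close>, where the value is
  \<open>(h, h, h)\<close> up to an element of \<open>glue\<close>. Its components are three
  solutions with defects \<open>a\<close>, \<open>b\<close> and \<open>a + b\<close>, as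
  \<open>solution_by_central_shift\<close> requires.\<close>

lemma diagonal_verbally_closed: "verbally_closed_in (\<Delta> ` carrier G) amalgam"
proof -
  interpret T: group triples by (rule group_triples)
  interpret P: group amalgam by (rule group_amalgam)
  interpret \<Delta>: group_hom G amalgam "\<Delta>"
    using diagonal_mon by unfold_locales (simp add: mon_def)
  have sub: "subgroup (\<Delta> ` carrier G) amalgam" by (rule \<Delta>.img_is_subgroup)
  show ?thesis
    unfolding P.verbally_closed_in_words
  proof (intro conjI sub allI ballI iffI)
    fix r w k
    assume w: "w \<in> words {..<r::nat}" and k: "k \<in> \<Delta> ` carrier G"
      and "\<exists>x\<in>{..<r} \<rightarrow> carrier amalgam. word_eval amalgam x w = k"
    then obtain x h where x: "x \<in> {..<r} \<rightarrow> carrier amalgam" "word_eval amalgam x w = \<Delta> h"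
        and h: "h \<in> carrier G" "k = \<Delta> h"
      by auto
    have "\<forall>i\<in>{..<r}. \<exists>t. t \<in> carrier triples \<and> x i = \<pi> t"
      using x(1) unfolding carrier_amalgam Pi_iff image_iff by blast
    then obtain t where t: "\<And>i. i \<in> {..<r} \<Longrightarrow> t i \<in> carrier triples \<and> x i = \<pi> (t i)"
      by metis
    have tT: "t \<in> {..<r} \<rightarrow> carrier triples" using t by auto
    have "\<pi> (word_eval triples t w) = word_eval amalgam (\<pi> \<circ> t) w"
      by (rule word_eval_hom[OF group_triples group_amalgam coset_map_hom w tT])
    also have "\<dots> = word_eval amalgam x w"
      using t by (intro word_eval_cong[OF w]) simp
    finally have "\<pi> (word_eval triples t w) = \<Delta> h" using x by simp
    then have "\<exists>a b :: int. word_eval triples t w = (z [^] a \<otimes> h, z [^] b \<otimes> h, z [^] (a + b) \<otimes> h)"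
      using T.word_eval_closed[OF w tT] h(1) by (intro coset_map_eqD) simp_all
    then obtain a b :: int where
      ab: "word_eval triples t w = (z [^] a \<otimes> h, z [^] b \<otimes> h, z [^] (a + b) \<otimes> h)"
      by blast
    define pr :: "nat \<Rightarrow> 'a \<times> 'a \<times> 'a \<Rightarrow> 'a" where
      "pr j = (if j = 0 then fst else if j = 1 then fst \<circ> snd else snd \<circ> snd)" for j
    define s where "s j = (if j = 0 then a else if j = 1 then b else a + b)" for j :: nat
    have pr: "pr j \<in> hom triples G" for j
      by (rule homI) (auto simp: pr_def split: prod.splits)
    have "\<exists>v \<in> {..<r} \<rightarrow> carrier G. word_eval G v w = h"
    proof (rule solution_by_central_shift[OF w h(1), of "\<lambda>j. pr j \<circ> t" s])
      show "pr j \<circ> t \<in> {..<r} \<rightarrow> carrier G" for j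
        using tT hom_in_carrier[OF pr] by (auto simp: Pi_iff)
      show "word_eval G (pr j \<circ> t) w = h \<otimes> z [^] s j" for j
      proof -
        have "word_eval G (pr j \<circ> t) w = pr j (word_eval triples t w)"
          using word_eval_hom[OF group_triples is_group pr w tT] by simp
        also have "\<dots> = z [^] s j \<otimes> h" by (simp add: ab pr_def s_def)
        finally show ?thesis by (simp only: z_pow_comm[OF h(1)])
      qed
      \<comment> \<open>Membership in \<open>triples\<close> compares only the first component with
        the other two; the remaining congruences follow by subtraction and change of sign.\<close>
      show "e d dvd e ((pr i \<circ> t) l) - e ((pr j \<circ> t) l)" if "l \<in> {..<r}" for i j l
      proof -
        obtain p q m where pqm: "t l = (p, q, m)" by (cases "t l")
        then have pq: "e d dvd e p - e q" and pm: "e d dvd e p - e m"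
          using t[OF that] by simp_all
        have "e q - e m = (e p - e m) - (e p - e q)" by simp
        then have "e d dvd e q - e m" using pq pm by (metis dvd_diff)
        with pq pm have "e d dvd e q - e p" "e d dvd e m - e p" "e d dvd e m - e q" "e d dvd e q - e m"
          by (simp_all only: dvd_diff_commute)
        with pq pm show ?thesis by (simp add: pr_def pqm)
      qed
    qed (simp add: s_def)
    then obtain v where v: "v \<in> {..<r} \<rightarrow> carrier G" "word_eval G v w = h" by blast
    have "word_eval amalgam (\<Delta> \<circ> v) w = k"
      using word_eval_hom[OF is_group group_amalgam \<Delta>.homh w v(1)] v h by simp
    then show "\<exists>x\<in>{..<r} \<rightarrow> \<Delta> ` carrier G. word_eval amalgam x w = k"
      using v by (intro bexI[of _ "\<Delta> \<circ> v"]) auto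
  next
    fix r w k
    assume "\<exists>x\<in>{..<r::nat} \<rightarrow> \<Delta> ` carrier G. word_eval amalgam x w = k"
    then show "\<exists>x\<in>{..<r} \<rightarrow> carrier amalgam. word_eval amalgam x w = k"
      using subgroup.subset[OF sub] by blast
  qed
qed

text \<open>The unknowns \<open>x\<^sub>0 = (d, 1, 1)\<close>, \<open>x\<^sub>1 = (1, d, 1)\<close>, \<open>x\<^sub>2 = (1, 1, g)\<close>, \<open>x\<^sub>3 = (g, 1, 1)\<close>,
  \<open>x\<^sub>4 = (1, g, 1)\<close> are numbered so that the residue modulo 3 is the position of the component.\<close>

definition solution :: "'a \<Rightarrow> nat \<Rightarrow> 'a \<times> 'a \<times> 'a" where
  "solution g i = (let c = (if i < 2 then d else g) in
    (if i mod 3 = 0 then c else \<one>, if i mod 3 = 1 then c else \<one>, if i mod 3 = 2 then c else \<one>))"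

lemma solution_triples: "g \<in> carrier G \<Longrightarrow> e d dvd e g \<Longrightarrow> solution g i \<in> carrier triples"
  by (auto simp: solution_def Let_def e_one)

text \<open>Conjugation by a diagonal triple keeps the position of the nontrivial component, and
  triples supported in different positions commute.\<close>

lemma solution_commute:
  assumes "g \<in> carrier G" "h \<in> carrier G" "i mod 3 \<noteq> j mod 3"
  shows "group.conj_commute triples (h, h, h) (solution g i) (solution g j)"
  using assms by (auto simp: group.conj_commute_def[OF group_triples] inv_triples solution_def Let_def)

lemma solution_amalgam:
  assumes g: "g \<in> carrier G" "e d dvd e g"
  shows "\<pi> (solution g 0) \<otimes>\<^bsub>amalgam\<^esub> \<pi> (solution g 0) = \<Delta> z"
    and "\<pi> (solution g 1) \<otimes>\<^bsub>amalgam\<^esub> \<pi> (solution g 1) = \<Delta> z"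
    and "\<pi> (solution g 3) \<otimes>\<^bsub>amalgam\<^esub> \<pi> (solution g 4) \<otimes>\<^bsub>amalgam\<^esub> \<pi> (solution g 2) = \<Delta> g"
    and "h \<in> carrier G \<Longrightarrow> i mod 3 \<noteq> j mod 3 \<Longrightarrow>
      group.conj_commute amalgam (\<Delta> h) (\<pi> (solution g i)) (\<pi> (solution g j))"
proof -
  interpret \<pi>: group_hom triples amalgam "\<pi>"
    using coset_map_hom group_triples group_amalgam
    by (simp add: group_hom_def group_hom_axioms_def)
  note sol = solution_triples[OF g]
  have m: "\<pi> s \<otimes>\<^bsub>amalgam\<^esub> \<pi> t = \<pi> (s \<otimes>\<^bsub>triples\<^esub> t)"
    if "s \<in> carrier triples" "t \<in> carrier triples" for s t
    using \<pi>.hom_mult[OF that] by (rule HOL.sym)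
  show "\<pi> (solution g 0) \<otimes>\<^bsub>amalgam\<^esub> \<pi> (solution g 0) = \<Delta> z"
    unfolding m[OF sol sol]
    \<comment> \<open>The square is \<open>(z, \<one>, \<one>)\<close>; the element
      \<open>(\<one>, z, z)\<close> of \<open>glue\<close> turns it into the diagonal triple. For
      the second square \<open>(z, \<one>, z)\<close> does the same.\<close>
    using coset_map_glue[of z \<one> \<one> 0 1] by (simp add: solution_def e_mult e_one)
  show "\<pi> (solution g 1) \<otimes>\<^bsub>amalgam\<^esub> \<pi> (solution g 1) = \<Delta> z"
    unfolding m[OF sol sol]
    using coset_map_glue[of \<one> z \<one> 1 0] by (simp add: solution_def e_mult e_one)
  show "\<pi> (solution g 3) \<otimes>\<^bsub>amalgam\<^esub> \<pi> (solution g 4) \<otimes>\<^bsub>amalgam\<^esub> \<pi> (solution g 2) = \<Delta> g"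
    unfolding m[OF sol sol] m[OF group.subgroup_self[OF group_triples, THEN subgroup.m_closed, OF sol sol] sol]
    using g by (simp add: solution_def)
  assume h: "h \<in> carrier G" and ij: "i mod 3 \<noteq> j mod 3"
  then have hT: "(h, h, h) \<in> carrier triples" by simp
  have "\<pi> ((h, h, h) \<otimes>\<^bsub>triples\<^esub> solution g i \<otimes>\<^bsub>triples\<^esub> inv\<^bsub>triples\<^esub> (h, h, h) \<otimes>\<^bsub>triples\<^esub> solution g j) =
      \<pi> (solution g j \<otimes>\<^bsub>triples\<^esub> ((h, h, h) \<otimes>\<^bsub>triples\<^esub> solution g i \<otimes>\<^bsub>triples\<^esub> inv\<^bsub>triples\<^esub> (h, h, h)))"
    using solution_commute[OF g(1) h ij] unfolding group.conj_commute_def[OF group_triples] by (rule arg_cong)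
  then show "group.conj_commute amalgam (\<Delta> h) (\<pi> (solution g i)) (\<pi> (solution g j))"
    unfolding group.conj_commute_def[OF group_amalgam]
    by (simp only: \<pi>.hom_mult \<pi>.hom_inv hT sol \<pi>.G.m_closed \<pi>.G.inv_closed)
qed

text \<open>Algebraic closedness replaces the solution in \<open>amalgam\<close> by a diagonal one,
  which injectivity reads back in \<open>G\<close>. \<open>E\<close> is finite because systems are;
  each application picks it rich enough. The condition on \<open>e g\<close> puts
  \<open>solution g i\<close> into \<open>triples\<close>.\<close>

theorem commuting_system_solvable:
  assumes svc: "strongly_verbally_closed G"
    and g: "g \<in> carrier G" "e d dvd e g"
    and E: "finite E" "E \<subseteq> carrier G"
  shows "\<exists>v \<in> {..<5::nat} \<rightarrow> carrier G. v 0 \<otimes> v 0 = z \<and> v 1 \<otimes> v 1 = z \<and> v 3 \<otimes> v 4 \<otimes> v 2 = g \<and>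
    (\<forall>h\<in>E. \<forall>i<5. \<forall>j<5. i mod 3 \<noteq> j mod 3 \<longrightarrow> conj_commute h (v i) (v j))"
proof -
  interpret \<Delta>: group_hom G amalgam "\<Delta>"
    using diagonal_mon group_amalgam is_group
    by (simp add: mon_def group_hom_def group_hom_axioms_def)
  let ?I = "\<Delta> ` carrier G" and ?L = "commuting_system (\<Delta> z) (\<Delta> g) (\<Delta> ` E)"
  have I: "\<Delta> z \<in> ?I" "\<Delta> g \<in> ?I" "\<Delta> ` E \<subseteq> ?I"
    by (rule imageI m_closed d g image_mono E)+
  have IP: "?I \<subseteq> carrier amalgam" using \<Delta>.hom_closed by blast
  note iff = \<Delta>.H.commuting_system_iff[OF subsetD[OF IP I(1)] subsetD[OF IP I(2)] subset_trans[OF I(3) IP]]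
  have sol: "(\<lambda>i. \<pi> (solution g i)) \<in> {..<5} \<rightarrow> carrier amalgam"
    using solution_triples[OF g] hom_in_carrier[OF coset_map_hom] by blast
  have "\<forall>w\<in>?L. word_eval amalgam (case_sum (\<lambda>h. h) (\<lambda>i. \<pi> (solution g i))) w = \<one>\<^bsub>amalgam\<^esub>"
    unfolding iff[OF sol] using solution_amalgam[OF g] E by blast
  moreover have "algebraically_closed_in ?I amalgam"
    by (rule strongly_verbally_closedD[OF svc group_amalgam diagonal_mon diagonal_verbally_closed])
  ultimately obtain x where x: "x \<in> {..<5} \<rightarrow> ?I"
      "\<forall>w\<in>?L. word_eval amalgam (case_sum (\<lambda>h. h) x) w = \<one>\<^bsub>amalgam\<^esub>"
    using finite_commuting_system[OF finite_imageI[OF E(1)]] commuting_system_words[OF I] sol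
    unfolding \<Delta>.H.algebraically_closed_in_words by meson
  have "\<forall>i\<in>{..<5}. \<exists>a. a \<in> carrier G \<and> x i = \<Delta> a"
    using x(1) unfolding Pi_iff image_iff by blast
  then obtain v where v: "\<And>i. i < 5 \<Longrightarrow> v i \<in> carrier G" "\<And>i. i < 5 \<Longrightarrow> x i = \<Delta> (v i)"
    by (metis lessThan_iff)
  have inj: "\<Delta> a = \<Delta> b \<Longrightarrow> a = b" if "a \<in> carrier G" "b \<in> carrier G" for a b
    using diagonal_mon that by (auto simp: mon_def inj_on_def)
  have xP: "x \<in> {..<5} \<rightarrow> carrier amalgam" using x(1) IP by blast
  have sys: "x 0 \<otimes>\<^bsub>amalgam\<^esub> x 0 = \<Delta> z" "x 1 \<otimes>\<^bsub>amalgam\<^esub> x 1 = \<Delta> z"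
    "x 3 \<otimes>\<^bsub>amalgam\<^esub> x 4 \<otimes>\<^bsub>amalgam\<^esub> x 2 = \<Delta> g"
    "\<And>h i j. h \<in> E \<Longrightarrow> i < 5 \<Longrightarrow> j < 5 \<Longrightarrow> i mod 3 \<noteq> j mod 3 \<Longrightarrow> \<Delta>.H.conj_commute (\<Delta> h) (x i) (x j)"
    using x(2) unfolding iff[OF xP] by blast+
  have lt: "(0::nat) < 5" "(1::nat) < 5" "(2::nat) < 5" "(3::nat) < 5" "(4::nat) < 5" by simp_all
  note sys' = sys(1-3)[unfolded v(2)[OF lt(1)] v(2)[OF lt(2)] v(2)[OF lt(3)] v(2)[OF lt(4)] v(2)[OF lt(5)]]
  show ?thesis
  proof (intro bexI[of _ v] conjI ballI allI impI)
    show "v \<in> {..<5} \<rightarrow> carrier G" using v by auto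
    show "v 0 \<otimes> v 0 = z"
      using sys'(1) v(1)[OF lt(1)] by (intro inj) (simp_all only: \<Delta>.hom_mult m_closed d)
    show "v 1 \<otimes> v 1 = z"
      using sys'(2) v(1)[OF lt(2)] by (intro inj) (simp_all only: \<Delta>.hom_mult m_closed d)
    show "v 3 \<otimes> v 4 \<otimes> v 2 = g"
      using sys'(3) v(1)[OF lt(3)] v(1)[OF lt(4)] v(1)[OF lt(5)] g(1)
      by (intro inj) (simp_all only: \<Delta>.hom_mult m_closed)
    show "conj_commute h (v i) (v j)"
      if "h \<in> E" "i < 5" "j < 5" "i mod 3 \<noteq> j mod 3" for h i j
    proof -
      have "h \<in> carrier G" "v i \<in> carrier G" "v j \<in> carrier G" using that E v by auto
      moreover have "\<Delta>.H.conj_commute (\<Delta> h) (\<Delta> (v i)) (\<Delta> (v j))"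
        using sys(4)[OF that] unfolding v(2)[OF that(2)] v(2)[OF that(3)] .
      ultimately show ?thesis
        unfolding \<Delta>.H.conj_commute_def conj_commute_def
        by (intro inj) (simp_all only: \<Delta>.hom_mult \<Delta>.hom_inv m_closed inv_closed)
    qed
  qed
qed

end


section \<open>Special linear groups\<close>

text \<open>The left factor adds \<open>c\<close> times row \<open>j\<close> to row
  \<open>i\<close>; the right factor then subtracts \<open>c\<close> times column \<open>i\<close>
  from column \<open>j\<close>.\<close>

lemma addrow_conj_index:
  fixes A :: "int mat"
  assumes A: "A \<in> carrier_mat n n" and ij: "i < n" "j < n" "i \<noteq> j" and kl: "k < n" "l < n"
  shows "(addrow_mat n c i j * A * addrow_mat n (- c) i j) $$ (k, l) =
    A $$ (k, l) + (if k = i then c * A $$ (j, l) else 0)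
    - (if l = j then c * (A $$ (k, i) + (if k = i then c * A $$ (j, i) else 0)) else 0)"
proof -
  have aX: "addrow_mat n c i j * A = addrow c i j A"
    using addrow_mat[OF A ij(2)] by simp
  have "addrow c i j A * addrow_mat n (- c) i j = addcol (- c) j i (addrow c i j A)"
    using addcol_mat[of "addrow c i j A" n n] A ij by simp
  then show ?thesis
    using A ij kl by (auto simp: aX algebra_simps)
qed

lemma mult_mat_index:
  fixes A B :: "int mat"
  assumes "A \<in> carrier_mat n n" "B \<in> carrier_mat n n" "k < n" "l < n"
  shows "(A * B) $$ (k, l) = (\<Sum>m<n. A $$ (k, m) * B $$ (m, l))"
  using assms by (auto simp: scalar_prod_def atLeast0LessThan)

text \<open>The commutation relations are quadratic in \<open>c\<close>. Their quadratic terms force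
  every product of an off-diagonal entry of \<open>A\<close> with an off-diagonal entry of
  \<open>B\<close> in the same column to vanish. So in column 0 one of the matrices has no
  off-diagonal entry, and its integer diagonal entry would have square -1.\<close>

lemma no_commuting_square_roots_of_minus_one:
  fixes A B :: "int mat"
  assumes A: "A \<in> carrier_mat n n" and B: "B \<in> carrier_mat n n" and n: "n > 0"
    and sq: "A * A = - 1\<^sub>m n" "B * B = - 1\<^sub>m n"
    and comm: "A * B = B * A"
    and conj: "\<And>i j c. i < n \<Longrightarrow> j < n \<Longrightarrow> i \<noteq> j \<Longrightarrow> c \<in> {1, -1} \<Longrightarrow>
      (addrow_mat n c i j * A * addrow_mat n (- c) i j) * B =
      B * (addrow_mat n c i j * A * addrow_mat n (- c) i j)"
  shows False
proof -
  have column: "A $$ (j, i) * B $$ (k, i) = 0"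
    if ij: "i < n" "j < n" "i \<noteq> j" and k: "k < n" "k \<noteq> i" for i j k
  proof -
    have id: "(A * B) $$ (k, j) = (B * A) $$ (k, j)" using comm by simp
    have eq: "(A * B) $$ (k, j) - c * A $$ (k, i) * B $$ (j, j) =
        (B * A) $$ (k, j) + c * B $$ (k, i) * A $$ (j, j) - c * (B * A) $$ (k, i)
        - c * c * B $$ (k, i) * A $$ (j, i)"
      if c: "c \<in> {1, -1}" for c
    proof -
      let ?C = "addrow_mat n c i j * A * addrow_mat n (- c) i j"
      have C: "?C \<in> carrier_mat n n" using A by auto
      have "(?C * B) $$ (k, j) = (\<Sum>m<n. A $$ (k, m) * B $$ (m, j) -
          (if m = j then c * A $$ (k, i) * B $$ (j, j) else 0))"
        unfolding mult_mat_index[OF C B k(1) ij(2)]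
        by (rule sum.cong) (use k in \<open>auto simp: addrow_conj_index[OF A ij] algebra_simps simp del: index_mult_mat(1)\<close>)
      also have "\<dots> = (A * B) $$ (k, j) - c * A $$ (k, i) * B $$ (j, j)"
        using ij by (simp add: sum_subtractf mult_mat_index[OF A B k(1) ij(2)])
      finally have l: "(?C * B) $$ (k, j) = (A * B) $$ (k, j) - c * A $$ (k, i) * B $$ (j, j)" .
      have "(B * ?C) $$ (k, j) = (\<Sum>m<n. B $$ (k, m) * A $$ (m, j) - c * (B $$ (k, m) * A $$ (m, i)) +
          (if m = i then c * B $$ (k, i) * A $$ (j, j) - c * c * B $$ (k, i) * A $$ (j, i) else 0))"
        unfolding mult_mat_index[OF B C k(1) ij(2)]
        by (rule sum.cong) (use ij in \<open>auto simp: addrow_conj_index[OF A ij] algebra_simps simp del: index_mult_mat(1)\<close>)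
      also have "\<dots> = (B * A) $$ (k, j) - c * (B * A) $$ (k, i) +
          (c * B $$ (k, i) * A $$ (j, j) - c * c * B $$ (k, i) * A $$ (j, i))"
        using ij by (simp add: sum.distrib sum_subtractf sum_distrib_left
            mult_mat_index[OF B A k(1) ij(2)] mult_mat_index[OF B A k(1) ij(1)])
      finally show ?thesis using l conj[OF ij c] by simp
    qed
    \<comment> \<open>Adding the cases \<open>c = 1\<close> and \<open>c = -1\<close> cancels the
      linear terms; by \<open>id\<close> only the quadratic one survives.\<close>
    show ?thesis using eq[of 1] eq[of "-1"] id by simp
  qed
  have diag: "D $$ (i, i) * D $$ (i, i) = -1"
    if D: "D \<in> carrier_mat n n" "D * D = - 1\<^sub>m n" and i: "i < n"
      and zero: "\<And>k. k < n \<Longrightarrow> k \<noteq> i \<Longrightarrow> D $$ (k, i) = 0" for D :: "int mat" and i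
  proof -
    have "(D * D) $$ (i, i) = (\<Sum>m<n. if m = i then D $$ (i, i) * D $$ (i, i) else 0)"
      unfolding mult_mat_index[OF D(1) D(1) i i] by (rule sum.cong) (use zero in auto)
    then show ?thesis using D i by simp
  qed
  have nonneg: "a * a \<noteq> - 1" for a :: int
    by (metis not_one_le_zero neg_0_le_iff_le zero_le_square)
  obtain j where j: "j < n" "j \<noteq> 0" "A $$ (j, 0) \<noteq> 0"
    using diag[OF A sq(1) n] nonneg by metis
  then have "B $$ (k, 0) = 0" if "k < n" "k \<noteq> 0" for k
    using column[OF n j(1), of k] that by simp
  then show False
    using diag[OF B sq(2) n] nonneg by metis
qed

text \<open>The standard complex structure in dimension \<open>2 * m\<close>. It plays the role of
  \<open>d\<close>, and here the evenness of the dimension enters.\<close>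

definition block_J :: "nat \<Rightarrow> int mat" where
  "block_J m = four_block_mat (0\<^sub>m m m) (1\<^sub>m m) (- 1\<^sub>m m) (0\<^sub>m m m)"

lemma block_J_carrier: "block_J m \<in> carrier (SL_int (2 * m))"
proof -
  have "det (block_J m) = det (0\<^sub>m m m * 0\<^sub>m m m - 1\<^sub>m m * (- 1\<^sub>m m) :: int mat)"
    unfolding block_J_def by (rule det_four_block_mat) auto
  also have "(0\<^sub>m m m * 0\<^sub>m m m - 1\<^sub>m m * (- 1\<^sub>m m) :: int mat) = 1\<^sub>m m"
    by (auto intro!: eq_matI)
  finally have "det (block_J m) = 1" by simp
  moreover have "block_J m \<in> carrier_mat (m + m) (m + m)"
    unfolding block_J_def by auto
  ultimately show ?thesis by (simp add: SL_int_def mult_2)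
qed

lemma block_J_square: "block_J m * block_J m = - 1\<^sub>m (2 * m)"
proof -
  have "block_J m * block_J m = four_block_mat (0\<^sub>m m m * 0\<^sub>m m m + 1\<^sub>m m * (- 1\<^sub>m m))
      (0\<^sub>m m m * 1\<^sub>m m + 1\<^sub>m m * 0\<^sub>m m m) (- 1\<^sub>m m * 0\<^sub>m m m + 0\<^sub>m m m * (- 1\<^sub>m m))
      (- 1\<^sub>m m * 1\<^sub>m m + 0\<^sub>m m m * 0\<^sub>m m m)"
    unfolding block_J_def by (rule mult_four_block_mat) auto
  also have "\<dots> = - 1\<^sub>m (2 * m)"
    by (rule eq_matI) (auto simp: four_block_mat_def Let_def)
  finally show ?thesis .
qed

theorem not_strongly_verbally_closed_SL_int:
  assumes "n > 0" "even n"
  shows "\<not> strongly_verbally_closed (SL_int n)"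
proof
  assume svc: "strongly_verbally_closed (SL_int n)"
  let ?G = "SL_int n"
  obtain m where m: "n = 2 * m" using assms(2) by (elim evenE)
  let ?J = "block_J m"
  interpret G: group ?G by (rule group_SL_int)
  have carr: "h \<in> carrier ?G \<longleftrightarrow> h \<in> carrier_mat n n \<and> det h = 1" for h
    by (simp add: SL_int_def)
  have mult: "a \<otimes>\<^bsub>?G\<^esub> b = a * b" and one: "\<one>\<^bsub>?G\<^esub> = 1\<^sub>m n" for a b
    by (simp_all add: SL_int_def)
  have J: "?J \<in> carrier ?G" "?J * ?J = - 1\<^sub>m n"
    using block_J_carrier[of m] block_J_square[of m] by (simp_all add: m)
  \<comment> \<open>With \<open>e\<close> zero the congruences are void, and \<open>e_d\<close>
    holds because -1 squares to the identity.\<close>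
  interpret square_root_of_center ?G ?J "\<lambda>_. 0"
  proof
    show "?J \<in> carrier ?G" by (rule J)
    show "h \<otimes>\<^bsub>?G\<^esub> (?J \<otimes>\<^bsub>?G\<^esub> ?J) = (?J \<otimes>\<^bsub>?G\<^esub> ?J) \<otimes>\<^bsub>?G\<^esub> h" if "h \<in> carrier ?G" for h
      using that by (auto simp: mult J carr)
    show "(0::int) \<noteq> 0 \<or> (?J \<otimes>\<^bsub>?G\<^esub> ?J) \<otimes>\<^bsub>?G\<^esub> (?J \<otimes>\<^bsub>?G\<^esub> ?J) = \<one>\<^bsub>?G\<^esub>"
      by (simp add: mult J one)
  qed simp
  define T where "T = (\<lambda>(i, j, c). addrow_mat n c i j :: int mat)"
  \<comment> \<open>The identity makes the two roots themselves commute; the elementary matrices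
    supply the conjugates.\<close>
  define E where "E = insert (1\<^sub>m n) (T ` {(i, j, c). i < n \<and> j < n \<and> i \<noteq> j \<and> c \<in> {1, -1}})"
  have "{(i, j, c :: int). i < n \<and> j < n \<and> i \<noteq> j \<and> c \<in> {1, -1}} \<subseteq> {..<n} \<times> {..<n} \<times> {1, -1}"
    by auto
  then have "finite E" unfolding E_def by (meson finite.simps finite_SigmaI finite_imageI finite_lessThan finite_subset)
  have Tc: "addrow_mat n c i j \<in> carrier ?G" if "i < n" "j < n" "i \<noteq> j" for i j c
    using that by (simp add: carr det_addrow_mat)
  then have "E \<subseteq> carrier ?G" by (auto simp: E_def T_def carr)
  have inv: "inv\<^bsub>?G\<^esub> (addrow_mat n c i j) = addrow_mat n (- c) i j" if "i < n" "j < n" "i \<noteq> j" for i j c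
    using addrow_mat_inv[OF that, of "- c"] that by (intro G.inv_equality) (simp_all add: mult one Tc)
  \<comment> \<open>Only the unknowns 0 and 1 matter here, so \<open>g\<close> is taken to be the
    identity.\<close>
  obtain v where v5: "v \<in> {..<5::nat} \<rightarrow> carrier ?G"
      and v: "v 0 * v 0 = - 1\<^sub>m n" "v 1 * v 1 = - 1\<^sub>m n"
      and conj: "\<And>h i j. h \<in> E \<Longrightarrow> i < 5 \<Longrightarrow> j < 5 \<Longrightarrow> i mod 3 \<noteq> j mod 3 \<Longrightarrow> G.conj_commute h (v i) (v j)"
    using commuting_system_solvable[OF svc G.one_closed dvd_refl \<open>finite E\<close> \<open>E \<subseteq> _\<close>]
    unfolding mult J by blast
  have comm: "G.conj_commute h (v 0) (v 1)" if "h \<in> E" for h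
    using conj[OF that, of 0 1] by simp
  have V: "v 0 \<in> carrier_mat n n" "v 1 \<in> carrier_mat n n" using v5 by (auto simp: carr Pi_iff)
  have "inv\<^bsub>?G\<^esub> 1\<^sub>m n = 1\<^sub>m n" using G.inv_one by (simp add: one)
  then have "v 0 * v 1 = v 1 * v 0"
    using comm[of "1\<^sub>m n"] V by (simp add: E_def G.conj_commute_def mult)
  moreover have "(addrow_mat n c i j * v 0 * addrow_mat n (- c) i j) * v 1 =
      v 1 * (addrow_mat n c i j * v 0 * addrow_mat n (- c) i j)"
    if "i < n" "j < n" "i \<noteq> j" "c \<in> {1, -1}" for i j c
  proof -
    have "addrow_mat n c i j \<in> E"
      unfolding E_def T_def using that by (intro insertI2 image_eqI[of _ _ "(i, j, c)"]) auto
    from comm[OF this] show ?thesis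
      unfolding G.conj_commute_def inv[OF that(1-3)] mult .
  qed
  ultimately show False
    using no_commuting_square_roots_of_minus_one[OF V assms(1) v] by blast
qed


section \<open>Braid groups\<close>

definition gen_class :: "'a set \<Rightarrow> ('a gword \<times> 'a gword) set \<Rightarrow> 'a \<Rightarrow> 'a gword set" where
  "gen_class S R a = pres_rel S R `` {[(a, True)]}"

lemma carrier_presented_group:
  "carrier (presented_group S R) = (\<lambda>w. pres_rel S R `` {w}) ` words S"
  by (auto simp: presented_group_def quotient_def)

lemma gen_class_closed: "a \<in> S \<Longrightarrow> gen_class S R a \<in> carrier (presented_group S R)"
  by (auto simp: gen_class_def carrier_presented_group)

lemma class_eq: "(u, w) \<in> pres_rel S R \<Longrightarrow> pres_rel S R `` {u} = pres_rel S R `` {w}"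
  using equiv_class_eq[OF equiv_pres_rel] .

text \<open>This serves to show that the relators hold among the generator classes and that these
  classes generate the group.\<close>

lemma word_eval_gen_class:
  "w \<in> words S \<Longrightarrow> word_eval (presented_group S R) (gen_class S R) w = pres_rel S R `` {w}"
proof (induction w)
  case Nil
  then show ?case by (simp add: presented_group_def)
next
  case (Cons p w)
  let ?G = "presented_group S R"
  interpret group ?G by (rule group_presented_group)
  obtain a b where p: "p = (a, b)" by (cases p)
  have a: "a \<in> S" and w: "w \<in> words S" using Cons.prems p by auto
  have "pres_rel S R `` {[(a, False)]} \<otimes>\<^bsub>?G\<^esub> gen_class S R a = \<one>\<^bsub>?G\<^esub>"
    using a class_eq[OF pres_rel.cancel[of "[]" S "[]" a False R]]
    by (simp add: gen_class_def presented_group_mult) (simp add: presented_group_def)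
  then have "inv\<^bsub>?G\<^esub> gen_class S R a = pres_rel S R `` {[(a, False)]}"
    using a gen_class_closed[OF a] by (intro inv_equality) (auto simp: carrier_presented_group)
  then have "(if b then gen_class S R a else inv\<^bsub>?G\<^esub> gen_class S R a) = pres_rel S R `` {[p]}"
    by (simp add: p gen_class_def)
  then have "word_eval ?G (gen_class S R) (p # w) =
      (pres_rel S R `` {[p]}) \<otimes>\<^bsub>?G\<^esub> (pres_rel S R `` {w})"
    unfolding word_eval_Cons p fst_conv snd_conv Cons.IH[OF w] by (simp only:)
  then show ?case
    using a w presented_group_mult[of "[p]" S w R] by (simp add: p)
qed

text \<open>Von Dyck's theorem: the value of a class does not depend on the representative once the
  relations hold. It yields the exponent sum and the map to \<open>link_group\<close>.\<close>

lemma value_at_hom: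
  assumes "group L" "v \<in> S \<rightarrow> carrier L"
    and R: "\<And>l r. (l, r) \<in> R \<Longrightarrow> word_eval L v l = word_eval L v r"
  shows "value_at L v \<in> hom (presented_group S R) L"
proof -
  interpret group L by fact
  note val = value_at_class[OF assms(2) R]
  show ?thesis
  proof (rule homI)
    fix x assume "x \<in> carrier (presented_group S R)"
    then obtain w where w: "w \<in> words S" "x = pres_rel S R `` {w}"
      by (auto simp: carrier_presented_group)
    then show "value_at L v x \<in> carrier L" using assms(2) by (simp add: val)
    fix y assume "y \<in> carrier (presented_group S R)"
    then obtain u where u: "u \<in> words S" "y = pres_rel S R `` {u}"
      by (auto simp: carrier_presented_group)
    then show "value_at L v (x \<otimes>\<^bsub>presented_group S R\<^esub> y) = value_at L v x \<otimes>\<^bsub>L\<^esub> value_at L v y"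
      using w by (simp add: presented_group_mult val word_eval_append[OF assms(2)])
  qed
qed

lemma value_at_gen_class:
  assumes "group L" "v \<in> S \<rightarrow> carrier L"
    and "\<And>l r. (l, r) \<in> R \<Longrightarrow> word_eval L v l = word_eval L v r" and "a \<in> S"
  shows "value_at L v (gen_class S R a) = v a"
proof -
  interpret group L by fact
  have "v a \<in> carrier L" using assms by auto
  then show ?thesis
    using value_at_class[OF assms(2,3), where w = "[(a, True)]"] assms(4) by (simp add: gen_class_def)
qed

lemma (in group) word_eval_commute:
  assumes "c \<in> carrier G" "v \<in> S \<rightarrow> carrier G" "\<And>a. a \<in> S \<Longrightarrow> v a \<otimes> c = c \<otimes> v a" "w \<in> words S"
  shows "word_eval G v w \<otimes> c = c \<otimes> word_eval G v w"
  using assms(4)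
proof (induction w)
  case Nil
  then show ?case using assms by simp
next
  case (Cons p w)
  define x where "x = (if snd p then v (fst p) else inv v (fst p))"
  have v: "v (fst p) \<in> carrier G" and W: "word_eval G v w \<in> carrier G" using Cons assms by auto
  then have x: "x \<in> carrier G" by (simp add: x_def)
  have "inv v (fst p) \<otimes> c = c \<otimes> inv v (fst p)"
    using assms(1) v assms(3)[of "fst p"] Cons.prems
    by (metis inv_closed inv_solve_left inv_solve_right m_assoc m_closed words_simps(2))
  then have "x \<otimes> c = c \<otimes> x"
    using assms(3)[of "fst p"] Cons.prems by (simp add: x_def)
  then have "x \<otimes> word_eval G v w \<otimes> c = c \<otimes> (x \<otimes> word_eval G v w)"
    using Cons x W assms(1) by (metis m_assoc words_simps(2))
  then show ?case by (simp add: x_def)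
qed

section \<open>The half twist and the centrality of its square\<close>

text \<open>In the braid group this carries strand 1 across the next \<open>k\<close> strands. It is
  formed in any group, so that the images in \<open>integer_group\<close> and
  \<open>link_group\<close> obey the same recursion.\<close>

primrec staircase :: "('g, 'm) monoid_scheme \<Rightarrow> (nat \<Rightarrow> 'g) \<Rightarrow> nat \<Rightarrow> 'g" where
  "staircase G s 0 = \<one>\<^bsub>G\<^esub>"
| "staircase G s (Suc k) = s (Suc k) \<otimes>\<^bsub>G\<^esub> staircase G s k"

text \<open>Garside's half twist on \<open>k\<close> strands.\<close>

primrec half_twist :: "('g, 'm) monoid_scheme \<Rightarrow> (nat \<Rightarrow> 'g) \<Rightarrow> nat \<Rightarrow> 'g" where
  "half_twist G s 0 = \<one>\<^bsub>G\<^esub>"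
| "half_twist G s (Suc k) = half_twist G s k \<otimes>\<^bsub>G\<^esub> staircase G s k"

text \<open>Besides the braid group, \<open>integer_group\<close> and \<open>link_group\<close> are
  instances, which provides the homomorphisms to them.\<close>

locale braid_relations = group +
  fixes s :: "nat \<Rightarrow> 'a" and n :: nat
  assumes s [simp]: "i \<in> {1..<n} \<Longrightarrow> s i \<in> carrier G"
    and far: "i \<in> {1..<n} \<Longrightarrow> j \<in> {1..<n} \<Longrightarrow> i + 2 \<le> j \<Longrightarrow> s i \<otimes> s j = s j \<otimes> s i"
    and braid: "i \<in> {1..<n} \<Longrightarrow> i + 1 \<in> {1..<n} \<Longrightarrow>
      s i \<otimes> (s (i + 1) \<otimes> s i) = s (i + 1) \<otimes> (s i \<otimes> s (i + 1))"
begin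

abbreviation "A \<equiv> staircase G s"
abbreviation "D \<equiv> half_twist G s"

lemma A_closed [simp]: "k < n \<Longrightarrow> A k \<in> carrier G"
  by (induction k) auto

lemma D_closed [simp]: "k \<le> n \<Longrightarrow> D k \<in> carrier G"
  by (induction k) auto

lemma s_A_far: "k + 2 \<le> j \<Longrightarrow> j < n \<Longrightarrow> s j \<otimes> A k = A k \<otimes> s j"
proof (induction k)
  case (Suc k)
  have "s j \<otimes> A (Suc k) = (s j \<otimes> s (Suc k)) \<otimes> A k"
    using Suc.prems by (simp add: m_assoc)
  also have "s j \<otimes> s (Suc k) = s (Suc k) \<otimes> s j"
    using far[of "Suc k" j] Suc.prems by simp
  also have "s (Suc k) \<otimes> s j \<otimes> A k = s (Suc k) \<otimes> (s j \<otimes> A k)"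
    using Suc.prems by (simp add: m_assoc)
  also have "\<dots> = A (Suc k) \<otimes> s j"
    using Suc by (simp add: m_assoc)
  finally show ?case .
qed simp

lemma s_D_far: "k + 1 \<le> j \<Longrightarrow> j < n \<Longrightarrow> s j \<otimes> D k = D k \<otimes> s j"
proof (induction k)
  case (Suc k)
  have "s j \<otimes> D (Suc k) = (s j \<otimes> D k) \<otimes> A k"
    using Suc.prems by (simp add: m_assoc)
  also have "\<dots> = D k \<otimes> (s j \<otimes> A k)"
    using Suc by (simp add: m_assoc)
  also have "\<dots> = D (Suc k) \<otimes> s j"
    using Suc.prems s_A_far[of k j] by (simp add: m_assoc)
  finally show ?case .
qed simp

text \<open>\<open>s i\<close> passes the factors of index above \<open>i + 1\<close> by
  \<open>far\<close>; at \<open>s (i + 1)\<close> and \<open>s i\<close> the braid relation raises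
  its index, after which it passes the rest.\<close>

lemma s_A: "1 \<le> i \<Longrightarrow> i < k \<Longrightarrow> k < n \<Longrightarrow> s i \<otimes> A k = A k \<otimes> s (i + 1)"
proof (induction k)
  case (Suc k)
  show ?case
  proof (cases "i = k")
    case False
    have "s i \<otimes> A (Suc k) = (s i \<otimes> s (Suc k)) \<otimes> A k"
      using Suc.prems by (simp add: m_assoc)
    also have "\<dots> = s (Suc k) \<otimes> (s i \<otimes> A k)"
      using far[of i "Suc k"] Suc.prems False by (simp add: m_assoc)
    also have "\<dots> = s (Suc k) \<otimes> (A k \<otimes> s (i + 1))"
      using Suc False by simp
    also have "\<dots> = A (Suc k) \<otimes> s (i + 1)"
      using Suc.prems by (simp add: m_assoc)
    finally show ?thesis .
  next
    case True
    then obtain l where l: "k = Suc l" using Suc.prems by (cases k) auto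
    have "s i \<otimes> A (Suc k) = (s k \<otimes> (s (k + 1) \<otimes> s k)) \<otimes> A l"
      using Suc.prems True l by (simp add: m_assoc)
    also have "\<dots> = s (k + 1) \<otimes> (s k \<otimes> (s (k + 1) \<otimes> A l))"
      using braid[of k] Suc.prems True l by (simp add: m_assoc)
    also have "\<dots> = s (k + 1) \<otimes> (s k \<otimes> (A l \<otimes> s (k + 1)))"
      using s_A_far[of l "k + 1"] Suc.prems l by simp
    also have "\<dots> = A (Suc k) \<otimes> s (i + 1)"
      using Suc.prems True l by (simp add: m_assoc)
    finally show ?thesis .
  qed
qed simp

text \<open>By \<open>s_A\<close>, moving the factors of \<open>A m\<close> through
  \<open>A k\<close> raises each index by one; the final \<open>s 1\<close> completes them to
  \<open>A (Suc m)\<close>.\<close>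

lemma A_A_s: "m < k \<Longrightarrow> k < n \<Longrightarrow> A m \<otimes> A k \<otimes> s 1 = A k \<otimes> A (Suc m)"
proof (induction m)
  case (Suc m)
  have "A (Suc m) \<otimes> A k \<otimes> s 1 = s (Suc m) \<otimes> (A m \<otimes> A k \<otimes> s 1)"
    using Suc.prems by (simp add: m_assoc)
  also have "\<dots> = (s (Suc m) \<otimes> A k) \<otimes> A (Suc m)"
    using Suc by (simp add: m_assoc del: staircase.simps)
  also have "\<dots> = A k \<otimes> (s (Suc (Suc m)) \<otimes> A (Suc m))"
    using s_A[of "Suc m" k] Suc.prems by (simp add: m_assoc del: staircase.simps)
  finally show ?case by simp
qed simp

text \<open>The half twist turns the strands over and so reflects the indices. In the induction step
  \<open>s_A\<close> handles all generators but the top one, and \<open>A_A_s\<close> handles that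
  one.\<close>

lemma s_D: "1 \<le> i \<Longrightarrow> i < k \<Longrightarrow> k \<le> n \<Longrightarrow> s i \<otimes> D k = D k \<otimes> s (k - i)"
proof (induction k arbitrary: i)
  case (Suc k)
  show ?case
  proof (cases "i = k")
    case False
    then have [simp]: "s (k - i) \<in> carrier G"
      using Suc.prems by (intro s) auto
    have "s i \<otimes> D (Suc k) = (s i \<otimes> D k) \<otimes> A k"
      using Suc.prems by (simp add: m_assoc)
    also have "\<dots> = D k \<otimes> (s (k - i) \<otimes> A k)"
      using Suc False by (simp add: m_assoc)
    also have "\<dots> = D k \<otimes> (A k \<otimes> s (k - i + 1))"
      using s_A[of "k - i" k] Suc.prems False by simp
    also have "\<dots> = D (Suc k) \<otimes> s (Suc k - i)"
      using Suc.prems False by (simp add: m_assoc Suc_diff_le)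
    finally show ?thesis .
  next
    case True
    then obtain l where l: "k = Suc l" using Suc.prems by (cases k) auto
    \<comment> \<open>\<open>D (Suc k)\<close> ends in \<open>A l \<otimes> A k\<close>;
      \<open>s k\<close> commutes with \<open>D l\<close> and extends \<open>A l\<close> to
      \<open>A k\<close>.\<close>
    have "s i \<otimes> D (Suc k) = (s k \<otimes> D l) \<otimes> (A l \<otimes> A k)"
      using Suc.prems True l by (simp add: m_assoc del: staircase.simps)
    also have "\<dots> = D l \<otimes> ((s k \<otimes> A l) \<otimes> A k)"
      using s_D_far[of l k] Suc.prems l by (simp add: m_assoc del: staircase.simps)
    also have "s k \<otimes> A l = A k" by (simp add: l)
    also have "A k \<otimes> A k = A l \<otimes> A k \<otimes> s 1"
      using A_A_s[of l k] Suc.prems l by simp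
    also have "D l \<otimes> (A l \<otimes> A k \<otimes> s 1) = D (Suc k) \<otimes> s (Suc k - i)"
      using Suc.prems True l by (simp add: m_assoc del: staircase.simps)
    finally show ?thesis .
  qed
qed simp

lemma s_full_twist:
  assumes "i \<in> {1..<n}"
  shows "s i \<otimes> (D n \<otimes> D n) = (D n \<otimes> D n) \<otimes> s i"
proof -
  have i: "1 \<le> i" "i < n" "1 \<le> n - i" "n - i < n" "n - (n - i) = i" using assms by auto
  then have [simp]: "s (n - i) \<in> carrier G" by (intro s) auto
  have "s i \<otimes> (D n \<otimes> D n) = (s i \<otimes> D n) \<otimes> D n"
    using assms by (simp add: m_assoc)
  also have "\<dots> = D n \<otimes> (s (n - i) \<otimes> D n)"
    using assms s_D[OF i(1,2)] by (simp add: m_assoc)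
  also have "\<dots> = (D n \<otimes> D n) \<otimes> s i"
    using assms s_D[OF i(3,4)] by (simp add: i(5) m_assoc)
  finally show ?thesis .
qed

lemma hom_half_twist:
  assumes "f \<in> hom G L" "group L" "\<And>i. i \<in> {1..<n} \<Longrightarrow> f (s i) = t i"
  shows "f (D n) = half_twist L t n"
proof -
  interpret f: group_hom G L f
    using assms is_group by (simp add: group_hom_def group_hom_axioms_def)
  have A: "f (A k) = staircase L t k" if "k < n" for k
    using that by (induction k) (auto simp: assms(3))
  have "f (D k) = half_twist L t k" if "k \<le> n" for k
    using that by (induction k) (auto simp: A)
  then show ?thesis by simp
qed

end

section \<open>Exponent sums, permutations and crossing counts of half twists\<close>

lemma staircase_int: "staircase integer_group (\<lambda>_. 1) k = int k"
  by (induction k) auto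

lemma half_twist_int: "2 * half_twist integer_group (\<lambda>_. 1) k = int k * (int k - 1)"
  by (induction k) (auto simp: staircase_int algebra_simps)

text \<open>A braid is recorded with its permutation and with the number of times strand \<open>i\<close> crosses strand \<open>j\<close>
  from left to right. Counting ordered pairs makes the count of the full twist odd for each pair.\<close>

definition link_group :: "nat \<Rightarrow> ((nat \<Rightarrow> nat) \<times> (nat \<Rightarrow> nat \<Rightarrow> int)) monoid" where
  "link_group n = \<lparr> carrier = {(p, c). p permutes {1..n}},
    monoid.mult = (\<lambda>(p, c) (q, d). (p \<circ> q, \<lambda>i j. d i j + c (q i) (q j))),
    one = (id, \<lambda>_ _. 0) \<rparr>"

definition crossing :: "nat \<Rightarrow> (nat \<Rightarrow> nat) \<times> (nat \<Rightarrow> nat \<Rightarrow> int)" where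
  "crossing k = (transpose k (Suc k), \<lambda>i j. of_bool (i = k \<and> j = Suc k))"

lemma link_group_simps [simp]:
  "(p, c) \<in> carrier (link_group n) \<longleftrightarrow> p permutes {1..n}"
  "(p, c) \<otimes>\<^bsub>link_group n\<^esub> (q, d) = (p \<circ> q, \<lambda>i j. d i j + c (q i) (q j))"
  "\<one>\<^bsub>link_group n\<^esub> = (id, \<lambda>_ _. 0)"
  by (auto simp: link_group_def)

lemma group_link_group: "group (link_group n)"
proof (rule groupI)
  fix x assume "x \<in> carrier (link_group n)"
  then obtain p c where x: "x = (p, c)" "p permutes {1..n}" by (cases x) auto
  then show "\<exists>y\<in>carrier (link_group n). y \<otimes>\<^bsub>link_group n\<^esub> x = \<one>\<^bsub>link_group n\<^esub>"
    using permutes_inv[OF x(2)] permutes_inv_o[OF x(2)] permutes_inverses[OF x(2)]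
    by (intro bexI[of _ "(inv_into UNIV p, \<lambda>i j. - c (inv_into UNIV p i) (inv_into UNIV p j))"]) simp_all
qed (auto simp: permutes_compose permutes_id fun_eq_iff)

lemma crossing_closed: "k \<in> {1..<n} \<Longrightarrow> crossing k \<in> carrier (link_group n)"
  by (auto simp: crossing_def intro!: permutes_swap_id)

lemma braid_relations_crossing: "braid_relations (link_group n) crossing n"
proof -
  interpret group "link_group n" by (rule group_link_group)
  show ?thesis
  proof
    show "crossing i \<in> carrier (link_group n)" if "i \<in> {1..<n}" for i
      by (rule crossing_closed[OF that])
    show "crossing i \<otimes>\<^bsub>link_group n\<^esub> crossing j = crossing j \<otimes>\<^bsub>link_group n\<^esub> crossing i"
      if "i + 2 \<le> j" for i j
      using that by (auto simp: crossing_def fun_eq_iff transpose_def)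
    show "crossing i \<otimes>\<^bsub>link_group n\<^esub> (crossing (i + 1) \<otimes>\<^bsub>link_group n\<^esub> crossing i) =
        crossing (i + 1) \<otimes>\<^bsub>link_group n\<^esub> (crossing i \<otimes>\<^bsub>link_group n\<^esub> crossing (i + 1))" for i
      by (auto simp: crossing_def fun_eq_iff transpose_def)
  qed
qed

lemma staircase_crossing: "staircase (link_group n) crossing k =
    (\<lambda>i. if i = 1 then k + 1 else if 2 \<le> i \<and> i \<le> k + 1 then i - 1 else i,
     \<lambda>i j. of_bool (i = 1 \<and> 2 \<le> j \<and> j \<le> k + 1))"
  by (induction k) (auto simp: crossing_def fun_eq_iff transpose_def)

text \<open>Each two strands cross exactly once, the one starting on the left passing to the
  right.\<close>

lemma half_twist_crossing: "half_twist (link_group n) crossing k =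
    (\<lambda>i. if 1 \<le> i \<and> i \<le> k then k + 1 - i else i, \<lambda>i j. of_bool (1 \<le> i \<and> i < j \<and> j \<le> k))"
  by (induction k) (auto simp: staircase_crossing fun_eq_iff)

section \<open>Two-transitivity and involutions of permutations\<close>

lemma transpositions_in_closed_set:
  assumes comp: "\<And>p q. p \<in> P \<Longrightarrow> q \<in> P \<Longrightarrow> p \<circ> q \<in> P"
    and adj: "\<And>k. k \<in> {1..<n} \<Longrightarrow> transpose k (Suc k) \<in> P"
    and "1 \<le> i" "i < j" "j \<le> n"
  shows "transpose i j \<in> P"
  using assms(4,5)
proof (induction j)
  case (Suc j)
  show ?case
  proof (cases "i = j")
    case True
    then show ?thesis using adj[of j] Suc assms(3) by simp
  next
    case False
    then have "transpose j (Suc j) \<circ> transpose i j \<circ> transpose j (Suc j) = transpose i (Suc j)"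
      using Suc.prems by (auto simp: fun_eq_iff transpose_def)
    moreover have "transpose j (Suc j) \<in> P" "transpose i j \<in> P"
      using adj[of j] Suc False assms(3) by auto
    ultimately show ?thesis using comp by metis
  qed
qed simp

lemma two_transitive_of_adjacent:
  fixes P :: "(nat \<Rightarrow> nat) set"
  assumes comp: "\<And>p q. p \<in> P \<Longrightarrow> q \<in> P \<Longrightarrow> p \<circ> q \<in> P" and "id \<in> P"
    and adj: "\<And>k. k \<in> {1..<n} \<Longrightarrow> transpose k (Suc k) \<in> P"
    and ijkl: "i \<in> {1..n}" "j \<in> {1..n}" "k \<in> {1..n}" "l \<in> {1..n}" "i \<noteq> j" "k \<noteq> l"
  shows "\<exists>p\<in>P. p i = k \<and> p j = l"
proof -
  have tr: "transpose a b \<in> P" if "a \<in> {1..n}" "b \<in> {1..n}" for a b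
  proof (cases a b rule: linorder_cases)
    case less
    then show ?thesis using that by (intro transpositions_in_closed_set[OF comp adj]) auto
  next
    case equal
    then show ?thesis using \<open>id \<in> P\<close> by simp
  next
    case greater
    then have "transpose b a \<in> P"
      using that by (intro transpositions_in_closed_set[OF comp adj]) auto
    then show ?thesis by (metis transpose_commute)
  qed
  \<comment> \<open>Once \<open>transpose i k\<close> has moved \<open>i\<close> to
    \<open>k\<close>, the image \<open>m\<close> of \<open>j\<close> must still go to
    \<open>l\<close>; \<open>transpose m l\<close> does this and fixes \<open>k\<close>.\<close>
  define m where "m = transpose i k j"
  have m: "m \<in> {1..n}" "m \<noteq> k" using ijkl by (auto simp: m_def transpose_def)
  have "(transpose m l \<circ> transpose i k) i = k" "(transpose m l \<circ> transpose i k) j = l"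
    using m ijkl by (auto simp: m_def transpose_def)
  then show ?thesis using comp[OF tr[OF m(1) ijkl(4)] tr[OF ijkl(1,3)]] by blast
qed

text \<open>Let \<open>b\<close> move \<open>i\<close> and \<open>a\<close> move \<open>k\<close>,
  and let \<open>h\<close> send \<open>i\<close> to \<open>k\<close> and \<open>b i\<close> to
  \<open>a k\<close>. The conjugate of \<open>b\<close> by \<open>h\<close> swaps \<open>k\<close>
  and \<open>a k\<close> and commutes with \<open>a\<close>; applying both to \<open>k\<close> gives
  \<open>a (a k) = k\<close>.\<close>

lemma involution_of_commuting_conjugates:
  fixes a b :: "'a \<Rightarrow> 'a"
  assumes a: "a permutes A" and b: "b permutes A" "b \<circ> b = id" "b \<noteq> id"
    and trans: "\<And>i j k l. i \<in> A \<Longrightarrow> j \<in> A \<Longrightarrow> k \<in> A \<Longrightarrow> l \<in> A \<Longrightarrow> i \<noteq> j \<Longrightarrow> k \<noteq> l \<Longrightarrow>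
      \<exists>h\<in>H. bij h \<and> h i = k \<and> h j = l"
    and comm: "\<And>h. h \<in> H \<Longrightarrow> (h \<circ> b \<circ> inv_into UNIV h) \<circ> a = a \<circ> (h \<circ> b \<circ> inv_into UNIV h)"
  shows "a \<circ> a = id"
proof -
  have bb: "b (b i) = i" for i using fun_cong[OF b(2), of i] by simp
  obtain i where i: "b i \<noteq> i" using b(3) by (auto simp: fun_eq_iff)
  then have iA: "i \<in> A" using b(1) by (auto simp: permutes_def)
  then have jA: "b i \<in> A" using permutes_in_image[OF b(1)] by simp
  have "a (a k) = k" for k
  proof (cases "a k = k")
    case False
    then have kA: "k \<in> A" using a by (auto simp: permutes_def)
    then have "a k \<in> A" using permutes_in_image[OF a] by simp
    then obtain h where h: "h \<in> H" "bij h" "h i = k" "h (b i) = a k"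
      using trans[of i "b i" k "a k"] iA jA kA i False by metis
    have "inv_into UNIV h k = i" "inv_into UNIV h (a k) = b i"
      using h by (metis bij_inv_eq_iff)+
    then show ?thesis
      using fun_cong[OF comm[OF h(1)], of k] h bb by simp
  qed simp
  then show ?thesis by (simp add: fun_eq_iff)
qed

lemma fst_link_group:
  "fst (x \<otimes>\<^bsub>link_group n\<^esub> y) = fst x \<circ> fst y"
  "x \<in> carrier (link_group n) \<longleftrightarrow> fst x permutes {1..n}"
  by (cases x; cases y; simp)+

section \<open>Non-abelian braid groups\<close>

theorem not_strongly_verbally_closed_braid_group:
  assumes n: "n \<ge> 3"
  shows "\<not> strongly_verbally_closed (braid_group n)"
proof
  assume svc: "strongly_verbally_closed (braid_group n)"
  define S where "S = {1..<n}"
  define R where "R = {([(i, True), (j, True)], [(j, True), (i, True)]) | i j. i \<in> {1..<n} \<and> j \<in> {1..<n} \<and> i + 2 \<le> j} \<union>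
     {([(i, True), (i + 1, True), (i, True)], [(i + 1, True), (i, True), (i + 1, True)]) | i.
        i \<in> {1..<n} \<and> i + 1 \<in> {1..<n}}"
  define B where "B = braid_group n"
  have B: "B = presented_group S R" by (simp add: B_def S_def R_def braid_group_def)
  define s where "s = gen_class S R"
  have group_B: "group B" unfolding B by (rule group_presented_group)
  interpret B: group B by (rule group_B)
  have R_eval: "word_eval L t l = word_eval L t r"
    if L: "braid_relations L t n" and lr: "(l, r) \<in> R" for L :: "('l, 'm) monoid_scheme" and t l r
  proof -
    interpret braid_relations L t n by fact
    consider i j where "i \<in> {1..<n}" "j \<in> {1..<n}" "i + 2 \<le> j"
        "l = [(i, True), (j, True)]" "r = [(j, True), (i, True)]"
      | i where "i \<in> {1..<n}" "i + 1 \<in> {1..<n}"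
        "l = [(i, True), (i + 1, True), (i, True)]" "r = [(i + 1, True), (i, True), (i + 1, True)]"
      using lr unfolding R_def by blast
    then show ?thesis
      by cases (use far braid s in \<open>simp_all del: atLeastLessThan_iff\<close>)
  qed
  have hom: "value_at L t \<in> hom B L" and hom_s: "\<And>i. i \<in> {1..<n} \<Longrightarrow> value_at L t (s i) = t i"
    if L: "braid_relations L t n" for L :: "('l, 'm) monoid_scheme" and t
  proof -
    interpret braid_relations L t n by fact
    have t: "t \<in> S \<rightarrow> carrier L" by (auto simp: S_def)
    show "value_at L t \<in> hom B L"
      unfolding B by (rule value_at_hom[OF is_group t R_eval[OF L]])
    show "value_at L t (s i) = t i" if "i \<in> {1..<n}" for i
      unfolding s_def using that by (intro value_at_gen_class[OF is_group t R_eval[OF L]]) (auto simp: S_def)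
  qed
  have s: "i \<in> {1..<n} \<Longrightarrow> s i \<in> carrier B" for i
    unfolding s_def B S_def by (rule gen_class_closed)
  have relators: "word_eval B s l = word_eval B s r" if lr: "(l, r) \<in> R" for l r
  proof -
    have w: "l \<in> words S" "r \<in> words S" using lr by (auto simp: R_def S_def)
    then have "(l, r) \<in> pres_rel S R" using pres_rel.relator[of "[]" S "[]" l r R] lr by simp
    then show ?thesis
      unfolding B s_def word_eval_gen_class[OF w(1)] word_eval_gen_class[OF w(2)] by (rule class_eq)
  qed
  interpret braid_relations B s n
  proof
    show "s i \<in> carrier B" if "i \<in> {1..<n}" for i by (rule s[OF that])
    show "s i \<otimes>\<^bsub>B\<^esub> s j = s j \<otimes>\<^bsub>B\<^esub> s i" if "i \<in> {1..<n}" "j \<in> {1..<n}" "i + 2 \<le> j" for i j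
      using relators[of "[(i, True), (j, True)]" "[(j, True), (i, True)]"] that s by (auto simp: R_def)
    show "s i \<otimes>\<^bsub>B\<^esub> (s (i + 1) \<otimes>\<^bsub>B\<^esub> s i) = s (i + 1) \<otimes>\<^bsub>B\<^esub> (s i \<otimes>\<^bsub>B\<^esub> s (i + 1))"
      if "i \<in> {1..<n}" "i + 1 \<in> {1..<n}" for i
      using relators[of "[(i, True), (i + 1, True), (i, True)]" "[(i + 1, True), (i, True), (i + 1, True)]"]
        that s[OF that(1)] s[OF that(2)] by (auto simp: R_def)
  qed
  \<comment> \<open>\<open>e\<close> is the exponent sum; \<open>f\<close> records the permutation
    and the ordered crossings.\<close>
  define e where "e = value_at integer_group (\<lambda>_::nat. 1)"
  define f where "f = value_at (link_group n) crossing"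
  have br_int: "braid_relations integer_group (\<lambda>_. 1) n"
    by unfold_locales (auto intro: exI[of _ "- _"] simp: integer_group_def Units_def)
  note br_link = braid_relations_crossing[of n]
  have e_hom: "e \<in> hom B integer_group" and f_hom: "f \<in> hom B (link_group n)"
    unfolding e_def f_def by (rule hom[OF br_int], rule hom[OF br_link])
  have e_s: "e (s i) = 1" and f_s: "f (s i) = crossing i" if "i \<in> {1..<n}" for i
    unfolding e_def f_def by (rule hom_s[OF br_int that], rule hom_s[OF br_link that])
  interpret e: group_hom B integer_group e
    using e_hom group_B by (simp add: group_hom_def group_hom_axioms_def)
  interpret f: group_hom B "link_group n" f
    using f_hom group_B group_link_group by (simp add: group_hom_def group_hom_axioms_def)
  have e_D: "2 * e (D n) = int n * (int n - 1)"
    using hom_half_twist[OF e_hom group_integer_group, of "\<lambda>_. 1"] e_s half_twist_int[of n] by simp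
  have f_D: "f (D n) = (\<lambda>i. if 1 \<le> i \<and> i \<le> n then n + 1 - i else i, \<lambda>i j. of_bool (1 \<le> i \<and> i < j \<and> j \<le> n))"
    using hom_half_twist[OF f_hom group_link_group, of crossing] f_s
    by (simp only: half_twist_crossing)
  interpret square_root_of_center B "D n" e
  proof
    show "D n \<in> carrier B" by simp
    show "h \<otimes>\<^bsub>B\<^esub> (D n \<otimes>\<^bsub>B\<^esub> D n) = (D n \<otimes>\<^bsub>B\<^esub> D n) \<otimes>\<^bsub>B\<^esub> h" if h: "h \<in> carrier B" for h
    proof -
      obtain w where w: "w \<in> words S" "h = word_eval B s w"
        using h word_eval_gen_class[of _ S R] unfolding B s_def carrier_presented_group by auto
      show ?thesis
        unfolding w(2) using w(1) s s_full_twist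
        by (intro B.word_eval_commute[of _ s S]) (auto simp: S_def)
    qed
    show "e (D n) \<noteq> 0 \<or> (D n \<otimes>\<^bsub>B\<^esub> D n) \<otimes>\<^bsub>B\<^esub> (D n \<otimes>\<^bsub>B\<^esub> D n) = \<one>\<^bsub>B\<^esub>"
      using e_D n by auto
  qed simp
  define \<rho> where "\<rho> h = fst (f h)" for h
  have \<rho>_mult: "\<rho> (a \<otimes>\<^bsub>B\<^esub> b) = \<rho> a \<circ> \<rho> b" if "a \<in> carrier B" "b \<in> carrier B" for a b
    unfolding \<rho>_def f.hom_mult[OF that] fst_link_group ..
  have \<rho>_one: "\<rho> \<one>\<^bsub>B\<^esub> = id" by (simp add: \<rho>_def)
  have \<rho>_perm: "\<rho> h permutes {1..n}" if "h \<in> carrier B" for h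
    using f.hom_closed[OF that] unfolding \<rho>_def fst_link_group .
  have \<rho>_inv: "\<rho> (inv\<^bsub>B\<^esub> h) = inv_into UNIV (\<rho> h)" if "h \<in> carrier B" for h
  proof (rule inv_unique_comp[symmetric])
    show "\<rho> h \<circ> \<rho> (inv\<^bsub>B\<^esub> h) = id" "\<rho> (inv\<^bsub>B\<^esub> h) \<circ> \<rho> h = id"
      using that by (simp_all add: \<rho>_one flip: \<rho>_mult)
  qed
  \<comment> \<open>One braid is chosen for each prescribed pair of images, so that finitely many
    conjugators already act two-transitively.\<close>
  define h where "h i j k l = (SOME a. a \<in> carrier B \<and> \<rho> a i = k \<and> \<rho> a j = l)" for i j k l
  have h: "h i j k l \<in> carrier B \<and> \<rho> (h i j k l) i = k \<and> \<rho> (h i j k l) j = l"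
    if ijkl: "i \<in> {1..n}" "j \<in> {1..n}" "k \<in> {1..n}" "l \<in> {1..n}" "i \<noteq> j" "k \<noteq> l" for i j k l
  proof -
    have "\<exists>p\<in>\<rho> ` carrier B. p i = k \<and> p j = l"
    proof (rule two_transitive_of_adjacent[OF _ _ _ ijkl])
      fix p q assume "p \<in> \<rho> ` carrier B" "q \<in> \<rho> ` carrier B"
      then obtain a b where "a \<in> carrier B" "b \<in> carrier B" "p = \<rho> a" "q = \<rho> b" by blast
      then show "p \<circ> q \<in> \<rho> ` carrier B"
        using \<rho>_mult[of a b] by (intro image_eqI[of _ _ "a \<otimes>\<^bsub>B\<^esub> b"]) simp_all
    next
      show "id \<in> \<rho> ` carrier B" 
        using \<rho>_one by (intro image_eqI[of _ _ "\<one>\<^bsub>B\<^esub>"]) simp_all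
    next
      fix m assume "m \<in> {1..<n}"
      then show "transpose m (Suc m) \<in> \<rho> ` carrier B"
        using f_s[of m] s[of m] by (intro image_eqI[of _ _ "s m"]) (simp_all add: \<rho>_def crossing_def)
    qed
    then have "\<exists>a. a \<in> carrier B \<and> \<rho> a i = k \<and> \<rho> a j = l" by blast
    then show ?thesis unfolding h_def by (rule someI_ex)
  qed
  define E where "E = insert \<one>\<^bsub>B\<^esub> ((\<lambda>(i, j, k, l). h i j k l) `
      {(i, j, k, l) \<in> {1..n} \<times> {1..n} \<times> {1..n} \<times> {1..n}. i \<noteq> j \<and> k \<noteq> l})"
  have "finite {(i, j, k, l) \<in> {1..n} \<times> {1..n} \<times> {1..n} \<times> {1..n}. i \<noteq> j \<and> k \<noteq> l}"
    by (rule finite_subset[of _ "{1..n} \<times> {1..n} \<times> {1..n} \<times> {1..n}"]) auto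
  moreover have "h i j k l \<in> carrier B"
    if "i \<in> {1..n}" "j \<in> {1..n}" "k \<in> {1..n}" "l \<in> {1..n}" "i \<noteq> j" "k \<noteq> l" for i j k l
    using h[OF that] by (rule conjunct1)
  ultimately have E: "finite E" "E \<subseteq> carrier B"
    unfolding E_def by (simp, intro insert_subsetI B.one_closed image_subsetI) (elim CollectE case_prodE, simp)
  \<comment> \<open>The exponent sum is 0, hence divisible by \<open>e (D n)\<close>, while the
    induced permutation is a 3-cycle.\<close>
  define g where "g = s 1 \<otimes>\<^bsub>B\<^esub> inv\<^bsub>B\<^esub> s 2"
  have s12: "s 1 \<in> carrier B" "s 2 \<in> carrier B" using s[of 1] s[of 2] n by auto
  have g: "g \<in> carrier B" using s12 by (simp add: g_def)
  have "e g = 0" unfolding g_def using s12 e_s[of 1] e_s[of 2] n by (simp add: e_mult e_inv)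
  then have "e (D n) dvd e g" by simp
  obtain v where v: "v \<in> {..<5::nat} \<rightarrow> carrier B" and
      v_sys: "v 0 \<otimes>\<^bsub>B\<^esub> v 0 = z \<and> v 1 \<otimes>\<^bsub>B\<^esub> v 1 = z \<and> v 3 \<otimes>\<^bsub>B\<^esub> v 4 \<otimes>\<^bsub>B\<^esub> v 2 = g \<and>
        (\<forall>a\<in>E. \<forall>i<5. \<forall>j<5. i mod 3 \<noteq> j mod 3 \<longrightarrow> B.conj_commute a (v i) (v j))"
    using commuting_system_solvable[OF svc[folded B_def] g \<open>e (D n) dvd e g\<close> E] by blast
  note v_sq = conjunct1[OF v_sys] conjunct1[OF conjunct2[OF v_sys]]
    and v_prod = conjunct1[OF conjunct2[OF conjunct2[OF v_sys]]]
  have v_conj: "B.conj_commute a (v i) (v j)"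
    if "a \<in> E" "i < 5" "j < 5" "i mod 3 \<noteq> j mod 3" for a i j
    using conjunct2[OF conjunct2[OF conjunct2[OF v_sys]]] that by blast
  have vB: "v i \<in> carrier B" if "i < 5" for i using v that by auto
  have E_conj: "(\<rho> a \<circ> \<rho> (v i) \<circ> inv_into UNIV (\<rho> a)) \<circ> \<rho> (v j) = \<rho> (v j) \<circ> (\<rho> a \<circ> \<rho> (v i) \<circ> inv_into UNIV (\<rho> a))"
    if "a \<in> E" "i < 5" "j < 5" "i mod 3 \<noteq> j mod 3" for a i j
  proof -
    have aB: "a \<in> carrier B" using that E by auto
    have "\<rho> ((a \<otimes>\<^bsub>B\<^esub> v i \<otimes>\<^bsub>B\<^esub> inv\<^bsub>B\<^esub> a) \<otimes>\<^bsub>B\<^esub> v j) = \<rho> (v j \<otimes>\<^bsub>B\<^esub> (a \<otimes>\<^bsub>B\<^esub> v i \<otimes>\<^bsub>B\<^esub> inv\<^bsub>B\<^esub> a))"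
      using v_conj[OF that] unfolding B.conj_commute_def by (simp only:)
    then show ?thesis
      using aB vB[OF that(2)] vB[OF that(3)] by (simp add: \<rho>_mult \<rho>_inv)
  qed
  \<comment> \<open>The second half twist meets the strands in reversed order and so counts the
    pairs with \<open>i > j\<close>.\<close>
  have f_z: "f z = (id, \<lambda>i j. of_bool (i \<noteq> j \<and> i \<in> {1..n} \<and> j \<in> {1..n}))"
    by (auto simp: f_D fun_eq_iff)
  \<comment> \<open>Squaring a pure braid doubles the count of the ordered pair of strands 1 and 2,
    but in the full twist this count is 1.\<close>
  have root: "\<rho> x \<circ> \<rho> x = id" "\<rho> x \<noteq> id" if x: "x \<in> carrier B" "x \<otimes>\<^bsub>B\<^esub> x = z" for x
  proof -
    obtain p c where pc: "f x = (p, c)" by (cases "f x")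
    have "(p \<circ> p, \<lambda>i j. c i j + c (p i) (p j)) = f z"
      using f.hom_mult[OF x(1) x(1)] x(2) pc by simp
    then have p: "p \<circ> p = id" and c: "c 1 2 + c (p 1) (p 2) = 1"
      using n unfolding f_z by (auto simp: fun_eq_iff)
    show "\<rho> x \<circ> \<rho> x = id" using p pc by (simp add: \<rho>_def)
    have "p \<noteq> id"
    proof
      assume "p = id"
      then have "2 * c 1 2 = 1" using c by simp
      then show False by presburger
    qed
    then show "\<rho> x \<noteq> id" using pc by (simp add: \<rho>_def)
  qed
  have involution: "\<rho> (v j) \<circ> \<rho> (v j) = id"
    if ij: "i < 5" "j < 5" "i mod 3 \<noteq> j mod 3" and sq: "v i \<otimes>\<^bsub>B\<^esub> v i = z" for i j
  proof (rule involution_of_commuting_conjugates[of _ "{1..n}" "\<rho> (v i)" "\<rho> ` E"])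
    show "\<rho> (v j) permutes {1..n}" "\<rho> (v i) permutes {1..n}" using vB ij \<rho>_perm by auto
    show "\<rho> (v i) \<circ> \<rho> (v i) = id" "\<rho> (v i) \<noteq> id" using root[OF vB[OF ij(1)] sq] by auto
    show "\<exists>p\<in>\<rho> ` E. bij p \<and> p a = c \<and> p b = d"
      if abcd: "a \<in> {1..n}" "b \<in> {1..n}" "c \<in> {1..n}" "d \<in> {1..n}" "a \<noteq> b" "c \<noteq> d" for a b c d
    proof -
      have "h a b c d \<in> E"
        unfolding E_def using abcd by (intro insertI2 image_eqI[of _ _ "(a, b, c, d)"]) auto
      then show ?thesis
        using h[OF abcd] permutes_bij[OF \<rho>_perm] by blast
    qed
    show "(p \<circ> \<rho> (v i) \<circ> inv_into UNIV p) \<circ> \<rho> (v j) = \<rho> (v j) \<circ> (p \<circ> \<rho> (v i) \<circ> inv_into UNIV p)"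
      if "p \<in> \<rho> ` E" for p
      using that E_conj[OF _ ij] by blast
  qed
  have comm: "\<rho> (v i) \<circ> \<rho> (v j) = \<rho> (v j) \<circ> \<rho> (v i)" if "i < 5" "j < 5" "i mod 3 \<noteq> j mod 3" for i j
    using E_conj[OF _ that, of "\<one>\<^bsub>B\<^esub>"] by (simp add: E_def \<rho>_one)
  \<comment> \<open>Each factor of \<open>g\<close> is paired with a root in another position modulo
    3: \<open>v 3\<close> with \<open>v 1\<close>, and \<open>v 4\<close> and \<open>v 2\<close>
    with \<open>v 0\<close>.\<close>
  have sq: "\<rho> (v 3) \<circ> \<rho> (v 3) = id" "\<rho> (v 4) \<circ> \<rho> (v 4) = id" "\<rho> (v 2) \<circ> \<rho> (v 2) = id"
    using involution[of 1 3] involution[of 0 4] involution[of 0 2] v_sq by simp_all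
  have cm: "\<rho> (v 4) \<circ> \<rho> (v 3) = \<rho> (v 3) \<circ> \<rho> (v 4)" "\<rho> (v 2) \<circ> \<rho> (v 3) = \<rho> (v 3) \<circ> \<rho> (v 2)"
    "\<rho> (v 2) \<circ> \<rho> (v 4) = \<rho> (v 4) \<circ> \<rho> (v 2)"
    using comm[of 4 3] comm[of 2 3] comm[of 2 4] by simp_all
  have \<rho>_g: "\<rho> g = \<rho> (v 3) \<circ> \<rho> (v 4) \<circ> \<rho> (v 2)"
    using vB by (simp add: \<rho>_mult flip: v_prod)
  \<comment> \<open>A product of commuting involutions squares to the identity.\<close>
  have "\<rho> g \<circ> \<rho> g = id"
  proof
    fix i
    note sq' = fun_cong[OF sq(1), simplified] fun_cong[OF sq(2), simplified] fun_cong[OF sq(3), simplified]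
    note cm' = fun_cong[OF cm(1), simplified] fun_cong[OF cm(2), simplified] fun_cong[OF cm(3), simplified]
    show "(\<rho> g \<circ> \<rho> g) i = id i" unfolding \<rho>_g by (simp add: sq' cm')
  qed
  moreover have "\<rho> g = transpose 1 2 \<circ> transpose 2 3"
  proof -
    have "\<rho> (s 1) = transpose 1 2" "\<rho> (s 2) = transpose 2 3"
      using f_s[of 1] f_s[of 2] n by (simp_all add: \<rho>_def crossing_def numeral_2_eq_2 numeral_3_eq_3)
    then show ?thesis
      using s12 by (simp add: g_def \<rho>_mult \<rho>_inv)
  qed
  \<comment> \<open>The square of the 3-cycle in fact sends 1 to 3.\<close>
  ultimately have "(transpose 1 2 \<circ> transpose 2 (3::nat) \<circ> (transpose 1 2 \<circ> transpose 2 3)) 1 = 1"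
    by simp
  then show False by (simp add: transpose_def)
qed

theorem mainTheorem5:
  shows "(\<forall>n\<ge>3. \<not> strongly_verbally_closed (braid_group n)) \<and>
         (\<forall>n>0. even n \<longrightarrow> \<not> strongly_verbally_closed (SL_int n))"
  using not_strongly_verbally_closed_braid_group not_strongly_verbally_closed_SL_int by blast

end
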